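(* Let $m\ge 0$ and $\ell\ge 0$ be fixed integers. Then $$\lim_{n\to\infty} d_{\rm TV}(M_n-b_n,\,Z_n)=0,\qquad\text{where}\qquad Z_n:=\lceil \xi_1+(e-1)\tau+c_n\rceil,$$ $\xi_1$ has the standard Gumbel distribution $\mathbb P[\xi_1\le x]=e^{-e^{-x}}$, $x\in\mathbb R$, and $\xi_1$ is independent of $\tau$, which has the ${\rm Gumbel}(\ell+1)$ distribution, i.e. density $\frac{1}{\ell!}\exp(-(\ell+1)s-e^{-s})$, $s\in\mathbb R$.
   Context: Let $(\Pi_i(t),t\ge 0)$, $i=1,2,\dots$, be i.i.d. unit-rate Poisson counting processes ($\Pi_i(t)$ is the number of balls in box $i$ at time $t$). For $n>\ell$ let $\tau_n:=\min\{t\ge 0:\Pi_i(t)>m\text{ for all but }\ell\text{ indices }i\in\{1,\dots,n\}\}$. The stopped maximum is $M_n:=\max_{1\le i\le n}\Pi_i(\tau_n)$. With $L:=\log n$, put $$a_n:=eL+\Big((e-1)m-\tfrac12\Big)\log L-\log\Big((e-1)(m!)^{e-1}\sqrt{2\pi e}\Big),\quad b_n:=\lfloor a_n\rfloor,\quad c_n:=a_n-\lfloor a_n\rfloor .$$ $d_{\rm TV}(X,Y)$ denotes the total variation distance between the distributions of $X$ and $Y$. *)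

theory Defs
  imports "HOL-Probability.Probability"
begin

text \<open>
  The paths are required to be counting paths for every \<open>\<omega>\<close>, not only almost surely, and only
  times \<open>t \<ge> 0\<close> matter. Since the paths are nondecreasing, the truncated subtraction on
  \<^typ>\<open>nat\<close> gives the true increments.
\<close>

locale unit_poisson_process = prob_space M for M :: "'a measure" +
  fixes N :: "real \<Rightarrow> 'a \<Rightarrow> nat"
  assumes measurable_process: "0 \<le> t \<Longrightarrow> N t \<in> measurable M (count_space UNIV)"
    and start_zero: "\<omega> \<in> space M \<Longrightarrow> N 0 \<omega> = 0"
    and nondecreasing: "\<omega> \<in> space M \<Longrightarrow> 0 \<le> s \<Longrightarrow> s \<le> t \<Longrightarrow> N s \<omega> \<le> N t \<omega>"
    and right_continuous:
      "\<omega> \<in> space M \<Longrightarrow> 0 \<le> t \<Longrightarrow> continuous (at_right t) (\<lambda>s. N s \<omega>)"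
    and poisson_increments:
      "0 \<le> s \<Longrightarrow> s < t \<Longrightarrow>
        distr M (count_space UNIV) (\<lambda>\<omega>. N t \<omega> - N s \<omega>) = measure_pmf (poisson_pmf (t - s))"
    and independent_increments:
      "0 \<le> u 0 \<Longrightarrow> (\<And>j. j < k \<Longrightarrow> u j < u (Suc j)) \<Longrightarrow>
        indep_vars (\<lambda>_. count_space UNIV) (\<lambda>j \<omega>. N (u (Suc j)) \<omega> - N (u j) \<omega>) {..<k::nat}"

text \<open>
  Boxes are numbered from 1. Each process is treated as a random element of the product space
  over all times \<open>t \<ge> 0\<close>, so that whole processes are independent. Identical distribution
  follows from each being a unit-rate Poisson process.
\<close>

definition iid_unit_poisson_processes ::
  "'a measure \<Rightarrow> (nat \<Rightarrow> real \<Rightarrow> 'a \<Rightarrow> nat) \<Rightarrow> bool" where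
  "iid_unit_poisson_processes M N \<longleftrightarrow>
    prob_space M \<and>
    (\<forall>i\<ge>1. unit_poisson_process M (N i)) \<and>
    prob_space.indep_vars M (\<lambda>_. PiM {0..} (\<lambda>_. count_space UNIV))
      (\<lambda>i \<omega>. \<lambda>t\<in>{0..}. N i t \<omega>) {1..}"

text \<open>
  ``All but \<open>l\<close>'' is read as ``all but at most \<open>l\<close>'': the first time with at most \<open>l\<close> exceptions
  is almost surely the first time with exactly \<open>l\<close> exceptions, since almost surely no two
  processes jump simultaneously. The minimum exists whenever \<open>stopping_set\<close> is nonempty, by
  right-continuity; the value 0 is used on the null event where it is empty.
\<close>

definition stopping_set ::
  "nat \<Rightarrow> nat \<Rightarrow> (nat \<Rightarrow> real \<Rightarrow> 'a \<Rightarrow> nat) \<Rightarrow> nat \<Rightarrow> 'a \<Rightarrow> real set" where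
  "stopping_set m l N n \<omega> = {t. 0 \<le> t \<and> card {i \<in> {1..n}. \<not> N i t \<omega> > m} \<le> l}"

definition stopping_time ::
  "nat \<Rightarrow> nat \<Rightarrow> (nat \<Rightarrow> real \<Rightarrow> 'a \<Rightarrow> nat) \<Rightarrow> nat \<Rightarrow> 'a \<Rightarrow> real" where
  "stopping_time m l N n \<omega> =
    (if stopping_set m l N n \<omega> = {} then 0 else (LEAST t. t \<in> stopping_set m l N n \<omega>))"

definition stopped_max ::
  "nat \<Rightarrow> nat \<Rightarrow> (nat \<Rightarrow> real \<Rightarrow> 'a \<Rightarrow> nat) \<Rightarrow> nat \<Rightarrow> 'a \<Rightarrow> nat" where
  "stopped_max m l N n \<omega> = Max ((\<lambda>i. N i (stopping_time m l N n \<omega>) \<omega>) ` {1..n})"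

definition a_seq :: "nat \<Rightarrow> nat \<Rightarrow> real" where
  "a_seq m n =
    (let e = exp 1; L = ln (real n) in
      e * L + ((e - 1) * real m - 1 / 2) * ln L
        - ln ((e - 1) * fact m powr (e - 1) * sqrt (2 * pi * e)))"

definition b_seq :: "nat \<Rightarrow> nat \<Rightarrow> int" where
  "b_seq m n = \<lfloor>a_seq m n\<rfloor>"

definition c_seq :: "nat \<Rightarrow> nat \<Rightarrow> real" where
  "c_seq m n = a_seq m n - of_int \<lfloor>a_seq m n\<rfloor>"

text \<open>Intended for probability measures on the same \<open>\<sigma>\<close>-algebra.\<close>

definition tv_dist :: "'a measure \<Rightarrow> 'a measure \<Rightarrow> real" where
  "tv_dist \<mu> \<nu> = (SUP A\<in>sets \<mu>. \<bar>measure \<mu> A - measure \<nu> A\<bar>)"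

text \<open>The density of the Gumbel(\<open>k\<close>) distribution is used for \<open>k \<ge> 1\<close>.\<close>

definition gumbel_density :: "nat \<Rightarrow> real \<Rightarrow> real" where
  "gumbel_density k s = exp (- (real k * s) - exp (- s)) / fact (k - 1)"

end

theory Submission
  imports Defs "HOL-Real_Asymp.Real_Asymp"
begin

text \<open>
  The maximum reaches level \<open>k\<close> by time \<open>t\<close> and the stopping time exceeds \<open>t\<close> for unrelated reasons:
  the first is caused by a few unusually full boxes, the second by a few unusually empty ones. At
  the critical time \<open>t = log n + m log log n - log m! + s\<close> a box is still low (at most \<open>m\<close> balls)
  with probability about \<open>exp (- s) / n\<close>, and it is high (more than \<open>k = a\<^sub>n + x\<close> balls) with
  probability about \<open>exp (- (x - (e - 1) s)) / n\<close>. One Poisson tail is elementary, the other needs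
  Stirling's formula (\<open>threshold_time_lower_tail\<close>, \<open>threshold_time_upper_tail\<close>). Being low at one
  time and high at another has probability \<open>o(1/n)\<close>. Since the boxes are independent, the number
  of low boxes is asymptotically Poisson and asymptotically independent of the absence of high ones:
  \<open>prob_stopped_by_and_all_low_limit\<close> shows that
  \<open>\<tau>\<^sub>n \<le> t\<close> and ``no box is high at time \<open>t'\<close>'' hold together with probability close to
  \<open>P (\<tau> < s) * P (\<xi> \<le> x - (e - 1) s')\<close>.

  It remains to evaluate the maximum at the random time \<open>\<tau>\<^sub>n\<close> with only fixed times at hand. If
  \<open>t\<^sub>j < \<tau>\<^sub>n \<le> t\<^sub>j\<^sub>+\<^sub>1\<close>, then monotonicity places the event \<open>M\<^sub>n \<le> k\<close> between ``no box is high at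
  \<open>t\<^sub>j\<^sub>+\<^sub>1\<close>'' and ``no box is high at \<open>t\<^sub>j\<close>''. Summing over a fixed finite grid bounds \<open>P (M\<^sub>n \<le> k)\<close>
  by two Riemann--Stieltjes sums. The event \<open>\<xi> + (e - 1) \<tau> \<le> x\<close> has the same monotone structure in
  \<open>\<tau>\<close>, so the same lemma (\<open>sandwich_stopped_event\<close>) bounds its probability by the same
  two sums, whose difference is small for a fine and wide grid. Hence the two probabilities
  differ by \<open>o(1)\<close> (\<open>grid_sandwiched_unique\<close>) and the convolution integral is never computed. All
  estimates hold for bounded sequences \<open>x\<^sub>n\<close>, because \<open>x\<^sub>n = r - c\<^sub>n\<close> keeps oscillating.

  Distribution functions that merge at every integer give total variation convergence, as the
  comparison variables are tight (\<open>tv_dist_tendsto_0\<close>).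
\<close>

section \<open>Stirling's formula and the upper Poisson tail\<close>

text \<open>
  The closed form of Wallis's product; it identifies the constant in Stirling's formula.
\<close>

lemma wallis_product_fact:
  "(\<Prod>k=1..n. (4 * real k ^ 2) / (4 * real k ^ 2 - 1)) =
     2 ^ (4 * n) * fact n ^ 4 / (fact (2 * n) ^ 2 * (2 * real n + 1))"
proof (induction n)
  case (Suc n)
  have f: "fact (2 * Suc n) = (2 * real n + 2) * ((2 * real n + 1) * fact (2 * n))"
    by (simp add: algebra_simps)
  have "(\<Prod>k=1..Suc n. (4 * real k ^ 2) / (4 * real k ^ 2 - 1)) =
     2 ^ (4 * n) * fact n ^ 4 / (fact (2 * n) ^ 2 * (2 * real n + 1)) *
     ((4 * real (Suc n) ^ 2) / (4 * real (Suc n) ^ 2 - 1))"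
    by (simp only: prod.nat_ivl_Suc' Suc.IH mult.commute)
  also have "4 * real (Suc n) ^ 2 - 1 = (2 * real n + 1) * (2 * real n + 3)"
    by (simp add: algebra_simps power2_eq_square)
  also have "2 ^ (4 * n) * fact n ^ 4 / (fact (2 * n) ^ 2 * (2 * real n + 1)) *
     ((4 * real (Suc n) ^ 2) / ((2 * real n + 1) * (2 * real n + 3))) =
     2 ^ (4 * Suc n) * fact (Suc n) ^ 4 / (fact (2 * Suc n) ^ 2 * (2 * real (Suc n) + 1))"
    unfolding f by (simp add: divide_simps) (simp add: algebra_simps power2_eq_square power4_eq_xxxx power_add)
  finally show ?case .
qed auto

text \<open>
  The increments of the sequence are \<open>O(1/n^2)\<close>, so it converges to some \<open>c\<close>. In the logarithm of
  Wallis's product it appears as \<open>4 d n - 2 d (2 n)\<close>, which turns the limit \<open>pi / 2\<close> into an equation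
  for \<open>c\<close>.
\<close>

lemma stirling_ln_fact:
  "(\<lambda>n. ln (fact n) - ((real n + 1/2) * ln (real n) - real n)) \<longlonglongrightarrow> ln (2 * pi) / 2"
proof -
  define d where "d n = ln (fact n) - ((real n + 1/2) * ln (real n) - real n)" for n :: nat
  have diff: "d (Suc n) - d (Suc (Suc n)) = (n + 3/2) * (ln (real n + 2) - ln (real n + 1)) - 1" for n
  proof -
    have "fact (Suc (Suc n)) = (real n + 2) * fact (Suc n)"
      by (simp add: algebra_simps)
    then have "ln (fact (Suc (Suc n)) :: real) = ln (real n + 2) + ln (fact (Suc n))"
      by (simp add: ln_mult del: fact_Suc)
    then show ?thesis
      unfolding d_def by (simp add: algebra_simps)
  qed
  have "(\<lambda>n. (real n + 3/2) * (ln (real n + 2) - ln (real n + 1)) - 1) \<in> O(\<lambda>n. 1 / real n ^ 2)"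
    by real_asymp
  then have "summable (\<lambda>n. (real n + 3/2) * (ln (real n + 2) - ln (real n + 1)) - 1)"
    by (rule summable_comparison_test_bigo[rotated]) (use inverse_power_summable[of 2, where ?'a = real] in \<open>simp add: field_simps\<close>)
  then have "summable (\<lambda>n. d (Suc n) - d (Suc (Suc n)))"
    by (simp add: diff)
  then have "convergent (\<lambda>n. \<Sum>i<n. d (Suc i) - d (Suc (Suc i)))"
    by (simp add: summable_iff_convergent)
  then have "convergent (\<lambda>n. d (Suc 0) - d (Suc n))"
    using sum_lessThan_telescope'[of "\<lambda>i. d (Suc i)"] by simp
  from convergent_diff[OF convergent_const[of "d (Suc 0)"] this] have "convergent (\<lambda>n. d (Suc n))"
    by simp
  then obtain c where "(\<lambda>n. d (Suc n)) \<longlonglongrightarrow> c"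
    by (auto simp: convergent_def)
  then have c: "d \<longlonglongrightarrow> c"
    by (simp only: filterlim_sequentially_Suc)
  have c2: "(\<lambda>n. d (2 * n)) \<longlonglongrightarrow> c"
    using LIMSEQ_subseq_LIMSEQ[OF c, of "\<lambda>n. 2 * n"] by (simp add: strict_mono_def o_def)
  have "(\<lambda>n. ln (2 ^ (4 * n) * fact n ^ 4 / (fact (2 * n) ^ 2 * (2 * real n + 1)))) \<longlonglongrightarrow> ln (pi / 2)"
    using wallis unfolding wallis_product_fact by (intro tendsto_ln) auto
  moreover have "eventually (\<lambda>n. ln (2 ^ (4 * n) * fact n ^ 4 / (fact (2 * n) ^ 2 * (2 * real n + 1))) =
      4 * d n - 2 * d (2 * n) + (ln (real n) - ln 2 - ln (2 * real n + 1))) sequentially"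
    using eventually_gt_at_top[of 0]
  proof eventually_elim
    case (elim n)
    have "ln (2 ^ (4 * n) * fact n ^ 4 / (fact (2 * n) ^ 2 * (2 * real n + 1))) =
        4 * real n * ln 2 + 4 * ln (fact n) - 2 * ln (fact (2 * n)) - ln (2 * real n + 1)"
      by (simp add: ln_mult ln_div ln_realpow)
    moreover have "ln (real (2 * n)) = ln 2 + ln (real n)"
      using elim by (simp add: ln_mult)
    ultimately show ?case
      by (simp add: d_def algebra_simps)
  qed
  ultimately have *: "(\<lambda>n. 4 * d n - 2 * d (2 * n) + (ln (real n) - ln 2 - ln (2 * real n + 1))) \<longlonglongrightarrow> ln (pi / 2)"
    by (rule Lim_transform_eventually)
  have "(\<lambda>n. ln (real n) - ln 2 - ln (2 * real n + 1)) \<longlonglongrightarrow> - (2 * ln 2)"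
    by real_asymp
  with c c2 have "(\<lambda>n. 4 * d n - 2 * d (2 * n) + (ln (real n) - ln 2 - ln (2 * real n + 1)))
      \<longlonglongrightarrow> 4 * c - 2 * c + (- (2 * ln 2))"
    by (intro tendsto_intros)
  with * have "ln (pi / 2) = 4 * c - 2 * c + (- (2 * ln 2))"
    by (rule LIMSEQ_unique)
  then have "c = ln (2 * pi) / 2"
    by (simp add: ln_mult ln_div)
  with c show ?thesis
    by (simp add: d_def[abs_def])
qed

lemma poisson_tail_suminf:
  assumes "t > 0"
  shows "measure (measure_pmf (poisson_pmf t)) {k<..} =
    pmf (poisson_pmf t) (Suc k) * (\<Sum>i. t ^ i * fact (Suc k) / fact (Suc k + i))"
proof -
  let ?r = "\<lambda>i. t ^ i * fact (Suc k) / fact (Suc k + i)"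
  let ?p = "pmf (poisson_pmf t) (Suc k)"
  have p: "?p > 0"
    using assms by (simp add: pmf_positive)
  have U: "(\<Union>i. {Suc k + i}) = {k<..}"
    by (auto simp: less_iff_Suc_add)
  have S: "(\<lambda>i. measure (measure_pmf (poisson_pmf t)) {Suc k + i}) sums
      measure (measure_pmf (poisson_pmf t)) (\<Union>i. {Suc k + i})"
    by (rule measure_pmf.finite_measure_UNION) (auto simp: disjoint_family_on_def)
  have eq: "measure (measure_pmf (poisson_pmf t)) {j + i} =
      pmf (poisson_pmf t) j * (t ^ i * fact j / fact (j + i))" for i j
    using assms by (simp add: measure_pmf_single power_add)
  have "(\<lambda>i. ?p * ?r i) sums measure (measure_pmf (poisson_pmf t)) {k<..}"
    using S unfolding U eq[of "Suc k"] .
  from sums_divide[OF this, of ?p] p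
  have "?r sums (measure (measure_pmf (poisson_pmf t)) {k<..} / ?p)"
    by (simp del: fact_Suc power_Suc)
  then show ?thesis
    using p by (simp add: sums_iff del: fact_Suc power_Suc)
qed

text \<open>
  Above a level \<open>k \<sim> e t\<close> successive atoms decrease by the factor \<open>t / k \<rightarrow> 1/e\<close>, so the tail
  is a geometric series times its first atom. Tannery's theorem justifies the passage to the limit,
  with dominating series \<open>(1/2)^i\<close> since \<open>e > 2\<close>.
\<close>

lemma poisson_tail_over_first_atom:
  fixes t :: "nat \<Rightarrow> real" and k :: "nat \<Rightarrow> nat"
  assumes t: "filterlim t at_top sequentially"
    and k: "(\<lambda>n. real (k n) / t n) \<longlonglongrightarrow> exp 1"
  shows "(\<lambda>n. measure (measure_pmf (poisson_pmf (t n))) {k n<..} / pmf (poisson_pmf (t n)) (Suc (k n)))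
    \<longlonglongrightarrow> 1 / (1 - exp (-1))"
proof -
  let ?a = "\<lambda>i n. t n ^ i * fact (Suc (k n)) / fact (Suc (k n) + i) :: real"
  have tpos: "eventually (\<lambda>n. t n > 0) sequentially"
    using t by (simp add: filterlim_at_top_dense)
  have e2: "2 < exp (1::real)"
    using exp_lower_Taylor_quadratic[of "1::real"] by simp
  have step: "?a (Suc i) n = ?a i n * (t n / (real (k n) + 2 + real i))" for i n
    by (simp add: field_simps)
  have ratio: "(\<lambda>n. t n / (real (k n) + 2 + real i)) \<longlonglongrightarrow> exp (-1)" for i
  proof -
    have "(\<lambda>n. real (k n) / t n + (2 + real i) / t n) \<longlonglongrightarrow> exp 1 + 0"
      by (intro tendsto_add k real_tendsto_divide_at_top[OF tendsto_const t])
    then have "(\<lambda>n. inverse (real (k n) / t n + (2 + real i) / t n)) \<longlonglongrightarrow> inverse (exp 1 + 0)"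
      by (rule tendsto_inverse) simp
    then show ?thesis
      by (simp add: add_divide_distrib[symmetric] exp_minus add.assoc)
  qed
  have lim: "(\<lambda>n. ?a i n) \<longlonglongrightarrow> exp (-1) ^ i" for i
  proof (induction i)
    case (Suc i)
    show ?case
      unfolding step unfolding power_Suc2[of "exp (-1)"] by (intro tendsto_mult Suc.IH ratio)
  qed simp
  have "eventually (\<lambda>n. real (k n) / t n > 2) sequentially"
    using k e2 by (rule order_tendstoD)
  with tpos have ev: "eventually (\<lambda>n. t n > 0 \<and> 2 * t n \<le> real (k n)) sequentially"
    by eventually_elim (simp add: field_simps)
  have bnd: "norm (?a i n) \<le> (1/2) ^ i" if "t n > 0 \<and> 2 * t n \<le> real (k n)" for i n
  proof (induction i)
    case (Suc i)
    have "t n / (real (k n) + 2 + real i) \<le> 1/2"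
      using that by (simp add: field_simps)
    with Suc.IH that show ?case
      unfolding step unfolding power_Suc2[of "1/2 :: real"] norm_mult by (intro mult_mono) auto
  qed simp
  have "eventually (\<lambda>(i,n). norm (?a i n) \<le> (1/2) ^ i) (at_top \<times>\<^sub>F sequentially)"
    unfolding eventually_prod_filter
    by (intro exI[of _ "\<lambda>_. True"] exI[of _ "\<lambda>n. t n > 0 \<and> 2 * t n \<le> real (k n)"])
       (use ev bnd in auto)
  with lim have "(\<lambda>n. suminf (\<lambda>i. ?a i n)) \<longlonglongrightarrow> suminf (\<lambda>i. exp (-1) ^ i)"
    using tannerys_theorem[of ?a "\<lambda>i. exp (-1) ^ i" sequentially "\<lambda>i. (1/2) ^ i"]
    by (simp add: summable_geometric del: fact_Suc)
  also have "suminf (\<lambda>i. exp (-1::real) ^ i) = 1 / (1 - exp (-1))"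
    by (rule suminf_geometric) simp
  finally have L: "(\<lambda>n. suminf (\<lambda>i. ?a i n)) \<longlonglongrightarrow> 1 / (1 - exp (-1))" .
  from tpos have "eventually (\<lambda>n. suminf (\<lambda>i. ?a i n) =
      measure (measure_pmf (poisson_pmf (t n))) {k n<..} / pmf (poisson_pmf (t n)) (Suc (k n))) sequentially"
  proof eventually_elim
    case (elim n)
    then have "pmf (poisson_pmf (t n)) (Suc (k n)) > 0"
      by (simp add: pmf_positive)
    then show ?case
      by (subst poisson_tail_suminf[OF elim]) simp
  qed
  with L show ?thesis
    by (rule Lim_transform_eventually)
qed

text \<open>
  Write \<open>j = e t (1 + y)\<close>. Stirling's formula leaves \<open>j (ln (1 + y) - y)\<close> and \<open>e t y^2\<close> as error terms.
  Both are of order \<open>t y^2\<close>, which is why the deviation \<open>j - e t\<close> must be \<open>o(sqrt t)\<close>.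
\<close>

lemma ln_pmf_poisson_asymptotic:
  fixes t :: "nat \<Rightarrow> real" and j :: "nat \<Rightarrow> nat"
  assumes t: "filterlim t at_top sequentially"
    and j: "(\<lambda>n. (real (j n) - exp 1 * t n) / sqrt (t n)) \<longlonglongrightarrow> 0"
  shows "(\<lambda>n. ln (pmf (poisson_pmf (t n)) (j n)) -
      ((exp 1 - 1) * t n - real (j n) - ln (2 * pi * exp 1 * t n) / 2)) \<longlonglongrightarrow> 0"
proof -
  define y where "y n = (real (j n) - exp 1 * t n) / (exp 1 * t n)" for n
  have tpos: "eventually (\<lambda>n. t n > 0) sequentially"
    using t by (simp add: filterlim_at_top_dense)
  have yt: "(\<lambda>n. y n * sqrt (t n)) \<longlonglongrightarrow> 0"
  proof -
    have "(\<lambda>n. (real (j n) - exp 1 * t n) / sqrt (t n) * exp (-1)) \<longlonglongrightarrow> 0 * exp (-1)"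
      by (intro tendsto_mult j tendsto_const)
    moreover have "eventually (\<lambda>n. (real (j n) - exp 1 * t n) / sqrt (t n) * exp (-1) = y n * sqrt (t n)) sequentially"
      using tpos by eventually_elim
        (simp add: y_def exp_minus field_simps)
    ultimately show ?thesis
      using Lim_transform_eventually by force
  qed
  have sqt: "filterlim (\<lambda>n. sqrt (t n)) at_top sequentially"
    by (rule filterlim_compose[OF sqrt_at_top t])
  have y0: "y \<longlonglongrightarrow> 0"
  proof -
    have "(\<lambda>n. y n * sqrt (t n) / sqrt (t n)) \<longlonglongrightarrow> 0"
      by (intro real_tendsto_divide_at_top[OF yt sqt])
    moreover have "eventually (\<lambda>n. y n * sqrt (t n) / sqrt (t n) = y n) sequentially"
      using tpos by eventually_elim simp
    ultimately show ?thesis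
      by (rule Lim_transform_eventually)
  qed
  have jeq: "eventually (\<lambda>n. real (j n) = exp 1 * t n * (1 + y n)) sequentially"
    using tpos by eventually_elim (simp add: y_def field_simps)
  have ysmall: "eventually (\<lambda>n. \<bar>y n\<bar> < 1/2) sequentially"
    using tendstoD[OF y0, of "1/2"] by (simp add: dist_real_def)
  have jtop: "filterlim j at_top sequentially"
  proof -
    have "filterlim (\<lambda>n. (1 + y n) * (exp 1 * t n)) at_top sequentially"
    proof (rule filterlim_tendsto_pos_mult_at_top)
      show "(\<lambda>n. 1 + y n) \<longlonglongrightarrow> 1 + 0"
        by (intro tendsto_intros y0)
      show "filterlim (\<lambda>n. exp 1 * t n) at_top sequentially"
        by (intro filterlim_tendsto_pos_mult_at_top[OF tendsto_const _ t]) simp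
    qed simp
    then have "filterlim (\<lambda>n. real (j n)) at_top sequentially"
      by (rule filterlim_mono_eventually) (use jeq in \<open>auto elim!: eventually_mono simp: mult_ac\<close>)
    then show ?thesis
      by (simp add: filterlim_sequentially_iff_filterlim_real)
  qed
  have S: "(\<lambda>n. ln (fact (j n)) - ((real (j n) + 1/2) * ln (real (j n)) - real (j n))) \<longlonglongrightarrow> ln (2 * pi) / 2"
    using filterlim_compose[OF stirling_ln_fact jtop] by simp
  have ln0: "(\<lambda>n. ln (1 + y n)) \<longlonglongrightarrow> ln (1 + 0)"
    by (intro tendsto_intros y0) simp
  have q: "(\<lambda>n. exp 1 * t n * (1 + y n) * (ln (1 + y n) - y n)) \<longlonglongrightarrow> 0"
  proof (rule Lim_null_comparison)
    show "eventually (\<lambda>n. norm (exp 1 * t n * (1 + y n) * (ln (1 + y n) - y n))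
        \<le> exp 1 * (1 + y n) * 2 * (y n * sqrt (t n)) ^ 2) sequentially"
      using tpos ysmall
    proof eventually_elim
      case (elim n)
      have "\<bar>ln (1 + y n) - y n\<bar> \<le> 2 * (y n)\<^sup>2"
        using elim by (intro abs_ln_one_plus_x_minus_x_bound) simp
      then have "exp 1 * t n * (1 + y n) * \<bar>ln (1 + y n) - y n\<bar> \<le> exp 1 * t n * (1 + y n) * (2 * (y n)\<^sup>2)"
        using elim by (intro mult_left_mono) auto
      moreover have "norm (exp 1 * t n * (1 + y n) * (ln (1 + y n) - y n)) =
          exp 1 * t n * (1 + y n) * \<bar>ln (1 + y n) - y n\<bar>"
        using elim by (simp add: abs_mult)
      moreover have "exp 1 * t n * (1 + y n) * (2 * (y n)\<^sup>2) = exp 1 * (1 + y n) * 2 * (y n * sqrt (t n)) ^ 2"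
        using elim by (simp add: power_mult_distrib)
      ultimately show ?case
        by simp
    qed
    have "(\<lambda>n. exp 1 * (1 + y n) * 2 * (y n * sqrt (t n)) ^ 2) \<longlonglongrightarrow> exp 1 * (1 + 0) * 2 * 0 ^ 2"
      by (intro tendsto_intros y0 yt)
    then show "(\<lambda>n. exp 1 * (1 + y n) * 2 * (y n * sqrt (t n)) ^ 2) \<longlonglongrightarrow> 0"
      by simp
  qed
  have r: "(\<lambda>n. exp 1 * (y n * sqrt (t n)) ^ 2) \<longlonglongrightarrow> exp 1 * 0 ^ 2"
    by (intro tendsto_intros yt)
  have "(\<lambda>n. - (exp 1 * t n * (1 + y n) * (ln (1 + y n) - y n)) - exp 1 * (y n * sqrt (t n)) ^ 2
      - ln (1 + y n) / 2 + ln (2 * pi) / 2 -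
      (ln (fact (j n)) - ((real (j n) + 1/2) * ln (real (j n)) - real (j n)))) \<longlonglongrightarrow>
      - 0 - exp 1 * 0 ^ 2 - ln (1 + 0) / 2 + ln (2 * pi) / 2 - ln (2 * pi) / 2"
    by (intro tendsto_intros q r ln0 S) simp
  moreover have "eventually (\<lambda>n. - (exp 1 * t n * (1 + y n) * (ln (1 + y n) - y n)) - exp 1 * (y n * sqrt (t n)) ^ 2
      - ln (1 + y n) / 2 + ln (2 * pi) / 2 -
      (ln (fact (j n)) - ((real (j n) + 1/2) * ln (real (j n)) - real (j n))) =
      ln (pmf (poisson_pmf (t n)) (j n)) -
      ((exp 1 - 1) * t n - real (j n) - ln (2 * pi * exp 1 * t n) / 2)) sequentially"
    using tpos ysmall jeq
  proof eventually_elim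
    case (elim n)
    have lnj: "ln (real (j n)) = 1 + ln (t n) + ln (1 + y n)"
      using elim by (simp add: ln_mult)
    have p: "ln (pmf (poisson_pmf (t n)) (j n)) = real (j n) * ln (t n) - ln (fact (j n)) - t n"
      using elim by (simp add: ln_mult ln_div ln_realpow)
    have l2: "ln (2 * pi * exp 1 * t n) = ln (2 * pi) + 1 + ln (t n)"
      using elim by (simp add: ln_mult)
    have sq: "(y n * sqrt (t n))\<^sup>2 = y n * y n * t n"
      using elim by (simp add: power_mult_distrib power2_eq_square)
    show ?case
      unfolding p l2 lnj sq using elim(3) by (simp add: algebra_simps)
  qed
  ultimately show ?thesis
    using Lim_transform_eventually by force
qed

lemma poisson_upper_tail_asymptotic:
  fixes t :: "nat \<Rightarrow> real" and k :: "nat \<Rightarrow> nat"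
  assumes t: "filterlim t at_top sequentially"
    and k: "(\<lambda>n. (real (Suc (k n)) - exp 1 * t n) / sqrt (t n)) \<longlonglongrightarrow> 0"
  shows "(\<lambda>n. ln (measure (measure_pmf (poisson_pmf (t n))) {k n<..}) -
      ((exp 1 - 1) * t n - real (k n) - ln (2 * pi * exp 1 * t n) / 2 - ln (exp 1 - 1))) \<longlonglongrightarrow> 0"
proof -
  have tpos: "eventually (\<lambda>n. t n > 0) sequentially"
    using t by (simp add: filterlim_at_top_dense)
  have sqt: "filterlim (\<lambda>n. sqrt (t n)) at_top sequentially"
    by (rule filterlim_compose[OF sqrt_at_top t])
  have "(\<lambda>n. (real (Suc (k n)) - exp 1 * t n) / sqrt (t n) / sqrt (t n) + exp 1 - 1 / t n) \<longlonglongrightarrow> 0 + exp 1 - 0"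
    by (intro tendsto_intros real_tendsto_divide_at_top[OF k sqt] real_tendsto_divide_at_top[OF tendsto_const t])
  moreover have "eventually (\<lambda>n. (real (Suc (k n)) - exp 1 * t n) / sqrt (t n) / sqrt (t n) + exp 1 - 1 / t n = real (k n) / t n) sequentially"
    using tpos by eventually_elim (simp add: field_simps)
  ultimately have "(\<lambda>n. real (k n) / t n) \<longlonglongrightarrow> exp 1"
    using Lim_transform_eventually by force
  note T = poisson_tail_over_first_atom[OF t this]
  have "(\<lambda>n. ln (measure (measure_pmf (poisson_pmf (t n))) {k n<..} / pmf (poisson_pmf (t n)) (Suc (k n)))
      + (ln (pmf (poisson_pmf (t n)) (Suc (k n))) -
      ((exp 1 - 1) * t n - real (Suc (k n)) - ln (2 * pi * exp 1 * t n) / 2)) - 1 + ln (exp 1 - 1))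
    \<longlonglongrightarrow> ln (1 / (1 - exp (-1))) + 0 - 1 + ln (exp 1 - 1)"
    by (intro tendsto_intros tendsto_ln[OF T] ln_pmf_poisson_asymptotic t k) auto
  also have "ln (1 / (1 - exp (-1))) = 1 - ln (exp 1 - 1 :: real)"
  proof -
    have "1 / (1 - exp (-1)) = exp 1 / (exp 1 - 1 :: real)"
      by (simp add: exp_minus field_simps)
    then show ?thesis
      by (simp add: ln_div)
  qed
  finally have "(\<lambda>n. ln (measure (measure_pmf (poisson_pmf (t n))) {k n<..} / pmf (poisson_pmf (t n)) (Suc (k n)))
      + (ln (pmf (poisson_pmf (t n)) (Suc (k n))) -
      ((exp 1 - 1) * t n - real (Suc (k n)) - ln (2 * pi * exp 1 * t n) / 2)) - 1 + ln (exp 1 - 1)) \<longlonglongrightarrow> 0"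
    by simp
  moreover have "eventually (\<lambda>n. ln (measure (measure_pmf (poisson_pmf (t n))) {k n<..} / pmf (poisson_pmf (t n)) (Suc (k n)))
      + (ln (pmf (poisson_pmf (t n)) (Suc (k n))) -
      ((exp 1 - 1) * t n - real (Suc (k n)) - ln (2 * pi * exp 1 * t n) / 2)) - 1 + ln (exp 1 - 1) =
      ln (measure (measure_pmf (poisson_pmf (t n))) {k n<..}) -
      ((exp 1 - 1) * t n - real (k n) - ln (2 * pi * exp 1 * t n) / 2 - ln (exp 1 - 1))) sequentially"
    using tpos
  proof eventually_elim
    case (elim n)
    have a: "pmf (poisson_pmf (t n)) (Suc (k n)) > 0"
      using elim by (simp only: pmf_positive set_pmf_poisson UNIV_I)
    also have "\<dots> \<le> measure (measure_pmf (poisson_pmf (t n))) {k n<..}"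
      unfolding measure_pmf_single[symmetric]
      by (intro measure_pmf.finite_measure_mono) auto
    finally have b: "measure (measure_pmf (poisson_pmf (t n))) {k n<..} > 0" .
    have "ln (measure (measure_pmf (poisson_pmf (t n))) {k n<..} / pmf (poisson_pmf (t n)) (Suc (k n))) =
        ln (measure (measure_pmf (poisson_pmf (t n))) {k n<..}) - ln (pmf (poisson_pmf (t n)) (Suc (k n)))"
      using a b by (metis ln_div less_irrefl)
    then show ?case
      by simp
  qed
  ultimately show ?thesis
    using Lim_transform_eventually by force
qed

section \<open>Poisson tails at the critical time\<close>

lemma bounded_over_diverging:
  fixes x f :: "nat \<Rightarrow> real"
  assumes "Bseq x" and "filterlim f at_top sequentially"
  shows "(\<lambda>n. x n / f n) \<longlonglongrightarrow> 0"
proof -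
  obtain K where K: "\<And>n. norm (x n) \<le> K"
    using assms(1) by (auto simp: Bseq_def)
  have "(\<lambda>n. x n * inverse (f n)) \<longlonglongrightarrow> 0"
  proof (rule Lim_null_comparison)
    show "eventually (\<lambda>n. norm (x n * inverse (f n)) \<le> K * norm (inverse (f n))) sequentially"
      unfolding norm_mult by (intro always_eventually allI mult_right_mono K norm_ge_zero)
    show "(\<lambda>n. K * norm (inverse (f n))) \<longlonglongrightarrow> 0"
      by (intro tendsto_mult_right_zero tendsto_norm_zero tendsto_inverse_0_at_top assms(2))
  qed
  then show ?thesis by (simp add: divide_inverse)
qed


text \<open>
  The window in which the number of boxes with at most \<open>m\<close> balls is of order one.
\<close>

definition threshold_time :: "nat \<Rightarrow> real \<Rightarrow> nat \<Rightarrow> real" where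
  "threshold_time m s n = ln (real n) + real m * ln (ln (real n)) - ln (fact m) + s"

lemma threshold_time_at_top: "filterlim (threshold_time m s) at_top sequentially"
  unfolding threshold_time_def[abs_def] by real_asymp

lemma threshold_time_over_ln: "(\<lambda>n. threshold_time m s n / ln (real n)) \<longlonglongrightarrow> 1"
  unfolding threshold_time_def[abs_def] by real_asymp

text \<open>
  Only the atom at \<open>m\<close> contributes: the atom at \<open>j\<close> is smaller by the factor \<open>(ln n)^(m - j)\<close>.
\<close>

lemma threshold_time_lower_tail:
  "(\<lambda>n. real n * measure (measure_pmf (poisson_pmf (threshold_time m s n))) {..m}) \<longlonglongrightarrow> exp (-s)"
proof -
  let ?t = "threshold_time m s"
  have ev: "eventually (\<lambda>n. ln (real n) > 0 \<and> ?t n > 0) sequentially"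
  proof -
    have "eventually (\<lambda>n. ln (real n) > 0) sequentially"
      by real_asymp
    moreover have "eventually (\<lambda>n. ?t n > 0) sequentially"
      using threshold_time_at_top[of m s] by (simp add: filterlim_at_top_dense)
    ultimately show ?thesis by eventually_elim simp
  qed
  have lim: "(\<lambda>n. (?t n / ln (real n)) ^ j * (1 / ln (real n)) ^ (m - j)) \<longlonglongrightarrow> 1 ^ j * 0 ^ (m - j)" for j
    by (intro tendsto_intros threshold_time_over_ln) real_asymp
  have "(\<lambda>n. fact m * exp (-s) * (\<Sum>j\<le>m. (?t n / ln (real n)) ^ j * (1 / ln (real n)) ^ (m - j) / fact j))
      \<longlonglongrightarrow> fact m * exp (-s) * (\<Sum>j\<le>m. 1 ^ j * 0 ^ (m - j) / fact j)"
    by (intro tendsto_mult tendsto_const tendsto_sum tendsto_divide lim) auto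
  also have "(\<Sum>j\<le>m. 1 ^ j * 0 ^ (m - j) / fact j) = (\<Sum>j\<le>m. if j = m then 1 / fact m else (0::real))"
    by (intro sum.cong) (auto simp: power_0_left)
  also have "fact m * exp (-s) * \<dots> = exp (-s)"
    by simp
  finally have "(\<lambda>n. fact m * exp (-s) * (\<Sum>j\<le>m. (?t n / ln (real n)) ^ j * (1 / ln (real n)) ^ (m - j) / fact j))
      \<longlonglongrightarrow> exp (-s)" .
  moreover have "eventually (\<lambda>n. fact m * exp (-s) * (\<Sum>j\<le>m. (?t n / ln (real n)) ^ j * (1 / ln (real n)) ^ (m - j) / fact j) =
      real n * measure (measure_pmf (poisson_pmf (?t n))) {..m}) sequentially"
    using ev eventually_gt_at_top[of 0]
  proof eventually_elim
    case (elim n)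
    define L where "L = ln (real n)"
    have L: "L > 0" and t: "?t n > 0"
      using elim by (auto simp: L_def)
    have e: "exp (- ?t n) * real n * L ^ m = fact m * exp (-s)"
    proof -
      have "exp (- ?t n) = exp (-s) * exp (ln (fact m)) / (exp L * exp (real m * ln L))"
        by (simp add: threshold_time_def L_def exp_diff exp_add exp_minus field_simps)
      also have "exp (real m * ln L) = L ^ m"
        using L by (simp add: exp_of_nat_mult)
      finally show ?thesis
        using elim L by (simp add: L_def field_simps)
    qed
    have "real n * measure (measure_pmf (poisson_pmf (?t n))) {..m} =
        (\<Sum>j\<le>m. real n * (?t n ^ j / fact j * exp (- ?t n)))"
      using t by (simp add: measure_measure_pmf_finite sum_distrib_left)
    also have "\<dots> = (\<Sum>j\<le>m. fact m * exp (-s) * ((?t n / L) ^ j * (1 / L) ^ (m - j) / fact j))"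
    proof (rule sum.cong[OF refl])
      fix j assume j: "j \<in> {..m}"
      have "L ^ m = L ^ j * L ^ (m - j)"
        using j by (simp flip: power_add)
      then show "real n * (?t n ^ j / fact j * exp (- ?t n)) =
          fact m * exp (-s) * ((?t n / L) ^ j * (1 / L) ^ (m - j) / fact j)"
        unfolding e[symmetric] using L by (simp add: field_simps)
    qed
    finally show ?case
      by (simp add: L_def sum_distrib_left)
  qed
  ultimately show ?thesis
    by (rule Lim_transform_eventually)
qed

text \<open>
  The centering \<open>a_seq\<close> is what makes the expected number of boxes with more than \<open>k\<close> balls of order
  one. The coefficient of \<open>s\<close> is \<open>e - 1\<close>: a delay \<open>s\<close> shifts \<open>e t - t\<close> by \<open>(e - 1) s\<close>.
\<close>

lemma threshold_time_upper_tail: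
  fixes k :: "nat \<Rightarrow> nat" and x :: "nat \<Rightarrow> real"
  assumes x: "Bseq x" and k: "eventually (\<lambda>n. real (k n) = a_seq m n + x n) sequentially"
  shows "(\<lambda>n. real n * measure (measure_pmf (poisson_pmf (threshold_time m s n))) {k n<..}
      - exp (- (x n - (exp 1 - 1) * s))) \<longlonglongrightarrow> 0"
proof -
  let ?t = "threshold_time m s"
  let ?P = "\<lambda>n. measure (measure_pmf (poisson_pmf (?t n))) {k n<..}"
  define C where "C = ln ((exp 1 - 1) * fact m powr (exp 1 - 1) * sqrt (2 * pi * exp 1))"
  have C: "C = ln (exp 1 - 1) + (exp 1 - 1) * ln (fact m) + (ln (2 * pi) + 1) / 2"
    by (simp add: C_def ln_mult ln_powr ln_sqrt)
  have a: "a_seq m n = exp 1 * ln (real n) + ((exp 1 - 1) * real m - 1/2) * ln (ln (real n)) - C" for n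
    by (simp add: a_seq_def C_def Let_def)
  have sq: "filterlim (\<lambda>n. sqrt (?t n)) at_top sequentially"
    by (rule filterlim_compose[OF sqrt_at_top threshold_time_at_top])
  \<comment> \<open>The deviation \<open>k + 1 - e t\<close> is only of order \<open>log log n\<close>, far below \<open>sqrt t\<close>.\<close>
  have "(\<lambda>n. (a_seq m n + 1 - exp 1 * ?t n) / sqrt (?t n)) \<longlonglongrightarrow> 0"
    unfolding a threshold_time_def by real_asymp
  from tendsto_add[OF this bounded_over_diverging[OF x sq]]
  have "(\<lambda>n. (a_seq m n + 1 - exp 1 * ?t n) / sqrt (?t n) + x n / sqrt (?t n)) \<longlonglongrightarrow> 0"
    by simp
  moreover have "eventually (\<lambda>n. (a_seq m n + 1 - exp 1 * ?t n) / sqrt (?t n) + x n / sqrt (?t n)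
      = (real (Suc (k n)) - exp 1 * ?t n) / sqrt (?t n)) sequentially"
    using k by eventually_elim (simp add: add_divide_distrib[symmetric] algebra_simps)
  ultimately have "(\<lambda>n. (real (Suc (k n)) - exp 1 * ?t n) / sqrt (?t n)) \<longlonglongrightarrow> 0"
    using Lim_transform_eventually by force
  note T = poisson_upper_tail_asymptotic[OF threshold_time_at_top this]
  have "(\<lambda>n. ln (?P n) - ((exp 1 - 1) * ?t n - real (k n) - ln (2 * pi * exp 1 * ?t n) / 2 - ln (exp 1 - 1))
      - ln (?t n / ln (real n)) / 2) \<longlonglongrightarrow> 0 - ln 1 / 2"
    by (intro tendsto_intros T threshold_time_over_ln) auto
  then have E: "(\<lambda>n. exp (ln (?P n) - ((exp 1 - 1) * ?t n - real (k n) - ln (2 * pi * exp 1 * ?t n) / 2 - ln (exp 1 - 1))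
      - ln (?t n / ln (real n)) / 2)) \<longlonglongrightarrow> exp 0"
    by (intro tendsto_exp) simp
  have ev: "eventually (\<lambda>n. ln (real n) > 0) sequentially"
    by real_asymp
  have evt: "eventually (\<lambda>n. ?t n > 0) sequentially"
    using threshold_time_at_top[of m s] by (simp add: filterlim_at_top_dense)
  have "eventually (\<lambda>n. exp (ln (?P n) - ((exp 1 - 1) * ?t n - real (k n) - ln (2 * pi * exp 1 * ?t n) / 2 - ln (exp 1 - 1))
      - ln (?t n / ln (real n)) / 2) = real n * ?P n * exp (x n - (exp 1 - 1) * s)) sequentially"
    using ev evt k eventually_gt_at_top[of 0]
  proof eventually_elim
    case (elim n)
    have "0 < pmf (poisson_pmf (?t n)) (Suc (k n))"
      using elim by (simp only: pmf_positive set_pmf_poisson UNIV_I)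
    also have "\<dots> \<le> ?P n"
      unfolding measure_pmf_single[symmetric]
      by (intro measure_pmf.finite_measure_mono) auto
    finally have P: "?P n > 0" .
    define L where "L = ln (real n)"
    have L: "L > 0" "exp L = real n"
      using elim by (auto simp: L_def)
    have "ln (?t n / L) = ln (?t n) - ln L"
      using elim L by (simp add: ln_div)
    moreover have "ln (2 * pi * exp 1 * ?t n) = ln (2 * pi) + 1 + ln (?t n)"
      using elim by (simp add: ln_mult)
    ultimately have "ln (?P n) - ((exp 1 - 1) * ?t n - real (k n) - ln (2 * pi * exp 1 * ?t n) / 2 - ln (exp 1 - 1))
      - ln (?t n / L) / 2 = ln (?P n) - (exp 1 - 1) * ?t n + real (k n) + (ln (2 * pi) + 1 + ln L) / 2 + ln (exp 1 - 1)"
      by (simp add: field_simps)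
    also have "\<dots> = L + ln (?P n) + (x n - (exp 1 - 1) * s)"
      using elim(3) unfolding a C threshold_time_def L_def[symmetric] by (simp add: field_simps)
    finally have eq: "ln (?P n) - ((exp 1 - 1) * ?t n - real (k n) - ln (2 * pi * exp 1 * ?t n) / 2 - ln (exp 1 - 1))
      - ln (?t n / L) / 2 = L + ln (?P n) + (x n - (exp 1 - 1) * s)" .
    show ?case
      unfolding L_def[symmetric] eq by (simp only: exp_add exp_ln[OF P] L)
  qed
  with E have R: "(\<lambda>n. real n * ?P n * exp (x n - (exp 1 - 1) * s)) \<longlonglongrightarrow> 1"
    using Lim_transform_eventually by force
  obtain K where K: "\<And>n. norm (x n) \<le> K"
    using x by (auto simp: Bseq_def)
  have cancel: "(p * exp z - 1) * exp (- z) = p - exp (- z)" for p z :: real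
    by (simp add: exp_minus left_diff_distrib)
  show ?thesis
  proof (rule Lim_null_comparison)
    show "eventually (\<lambda>n. norm (real n * ?P n - exp (- (x n - (exp 1 - 1) * s))) \<le>
        norm (real n * ?P n * exp (x n - (exp 1 - 1) * s) - 1) * exp (K + (exp 1 - 1) * s)) sequentially"
    proof (intro always_eventually allI)
      fix n
      have "real n * ?P n - exp (- (x n - (exp 1 - 1) * s)) =
        (real n * ?P n * exp (x n - (exp 1 - 1) * s) - 1) * exp (- (x n - (exp 1 - 1) * s))"
        by (rule cancel[symmetric])
      moreover have "exp (- (x n - (exp 1 - 1) * s)) \<le> exp (K + (exp 1 - 1) * s)"
        using K[of n] by auto
      ultimately show "norm (real n * ?P n - exp (- (x n - (exp 1 - 1) * s))) \<le>
        norm (real n * ?P n * exp (x n - (exp 1 - 1) * s) - 1) * exp (K + (exp 1 - 1) * s)"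
        by (simp only: norm_mult) (intro mult_left_mono, auto)
    qed
    have "(\<lambda>n. norm (real n * ?P n * exp (x n - (exp 1 - 1) * s) - 1) * exp (K + (exp 1 - 1) * s)) \<longlonglongrightarrow>
       norm (1 - 1 :: real) * exp (K + (exp 1 - 1) * s)"
      by (intro tendsto_intros R)
    then show "(\<lambda>n. norm (real n * ?P n * exp (x n - (exp 1 - 1) * s) - 1) * exp (K + (exp 1 - 1) * s)) \<longlonglongrightarrow> 0"
      by simp
  qed
qed

section \<open>The number of rare boxes\<close>

text \<open>
  Here \<open>y\<close> is bounded but need not converge, so the limit of \<open>(1 - y/n)^n\<close> is replaced by a
  comparison with \<open>exp (- y/n)^n\<close>, factor by factor.
\<close>

lemma power_minus_exp_tendsto_0:
  fixes v y :: "nat \<Rightarrow> real"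
  assumes v: "\<And>n. 0 \<le> v n" "\<And>n. v n \<le> 1"
    and y: "\<And>n. 0 \<le> y n" "Bseq y"
    and lim: "(\<lambda>n. real n * (1 - v n) - y n) \<longlonglongrightarrow> 0"
  shows "(\<lambda>n. v n ^ n - exp (- y n)) \<longlonglongrightarrow> 0"
proof -
  obtain K where K: "\<And>n. norm (y n) \<le> K"
    using y(2) by (auto simp: Bseq_def)
  show ?thesis
  proof (rule Lim_null_comparison)
    show "eventually (\<lambda>n. norm (v n ^ n - exp (- y n)) \<le> norm (real n * (1 - v n) - y n) + K^2 / real n) sequentially"
      using eventually_gt_at_top[of 0]
    proof eventually_elim
      case (elim n)
      define z where "z = y n / real n"
      have z: "z \<ge> 0"
        using y(1) by (simp add: z_def)
      have "exp (- y n) = exp (- z) ^ n"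
        using elim by (simp add: z_def flip: exp_of_nat_mult)
      then have "norm (v n ^ n - exp (- y n)) \<le> real n * norm (v n - exp (- z))"
        using norm_power_diff[of "v n" "exp (-z)" n] v[of n] z by simp
      also have "norm (v n - exp (- z)) \<le> norm ((1 - v n) - z) + norm (exp (-z) - (1 - z))"
        using norm_triangle_ineq[of "z - (1 - v n)" "(1 - z) - exp (-z)"] by (simp add: norm_minus_commute)
      also have "norm (exp (-z) - (1 - z)) \<le> z^2"
      proof -
        have "1 - z \<le> exp (- z)"
          using exp_ge_add_one_self[of "-z"] by simp
        moreover have "exp (- z) \<le> 1 - z + z^2"
        proof -
          have "exp (- z) \<le> 1 / (1 + z)"
            using exp_ge_add_one_self[of z] z by (simp add: exp_minus divide_simps)
          also have "1 / (1 + z) \<le> 1 - z + z^2"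
            using z by (simp add: field_simps power2_eq_square)
          finally show ?thesis .
        qed
        ultimately show ?thesis by simp
      qed
      also have "real n * (norm ((1 - v n) - z) + z^2) = norm (real n * ((1 - v n) - z)) + y n ^ 2 / real n"
        using elim by (simp add: abs_mult distrib_left z_def power2_eq_square)
      also have "real n * ((1 - v n) - z) = real n * (1 - v n) - y n"
        using elim by (simp add: z_def algebra_simps)
      also have "y n ^ 2 / real n \<le> K ^ 2 / real n"
        using K[of n] y(1)[of n] by (intro divide_right_mono power_mono) auto
      finally show ?case
        by (simp add: mult_left_mono)
    qed
    have "(\<lambda>n. norm (real n * (1 - v n) - y n) + K^2 / real n) \<longlonglongrightarrow> norm (0::real) + 0"
      by (intro tendsto_intros lim real_tendsto_divide_at_top[OF tendsto_const filterlim_real_sequentially])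
    then show "(\<lambda>n. norm (real n * (1 - v n) - y n) + K^2 / real n) \<longlonglongrightarrow> 0"
      by simp
  qed
qed

lemma choose_times_power_tendsto:
  fixes u :: "nat \<Rightarrow> real"
  assumes u: "(\<lambda>n. real n * u n) \<longlonglongrightarrow> \<alpha>"
  shows "(\<lambda>n. real (n choose r) * u n ^ r) \<longlonglongrightarrow> \<alpha> ^ r / fact r"
proof (induction r)
  case (Suc r)
  have "u \<longlonglongrightarrow> 0"
  proof -
    have "(\<lambda>n. real n * u n / real n) \<longlonglongrightarrow> 0"
      by (rule real_tendsto_divide_at_top[OF u filterlim_real_sequentially])
    moreover have "eventually (\<lambda>n. real n * u n / real n = u n) sequentially"
      using eventually_gt_at_top[of 0] by eventually_elim simp
    ultimately show ?thesis
      by (rule Lim_transform_eventually)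
  qed
  then have "(\<lambda>n. real (n choose r) * u n ^ r * ((real n * u n - real r * u n) / real (Suc r)))
      \<longlonglongrightarrow> \<alpha> ^ r / fact r * ((\<alpha> - real r * 0) / real (Suc r))"
    by (intro tendsto_intros Suc.IH u) auto
  moreover have "eventually (\<lambda>n. real (n choose r) * u n ^ r * ((real n * u n - real r * u n) / real (Suc r)) =
      real (n choose Suc r) * u n ^ Suc r) sequentially"
    using eventually_ge_at_top[of "Suc r"]
  proof eventually_elim
    case (elim n)
    have "Suc r * (n choose Suc r) = (n - r) * (n choose r)"
      using binomial_absorption[of r n] binomial_absorb_comp[of n r] by simp
    then have "real (Suc r) * real (n choose Suc r) = (real n - real r) * real (n choose r)"
      using elim by (simp flip: of_nat_mult of_nat_diff del: of_nat_Suc)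
    then have "real (n choose Suc r) = (real n - real r) * real (n choose r) / real (Suc r)"
      by (simp add: field_simps)
    then have "real (n choose Suc r) * u n ^ Suc r = ((real n - real r) * real (n choose r) / real (Suc r)) * u n ^ Suc r"
      by (rule arg_cong)
    also have "\<dots> = real (n choose r) * u n ^ r * ((real n * u n - real r * u n) / real (Suc r))"
      by (simp add: algebra_simps del: of_nat_Suc)
    finally show ?case
      by (rule sym)
  qed
  ultimately have "(\<lambda>n. real (n choose Suc r) * u n ^ Suc r) \<longlonglongrightarrow> \<alpha> ^ r / fact r * ((\<alpha> - real r * 0) / real (Suc r))"
    by (rule Lim_transform_eventually)
  then show ?case
    by (simp add: mult_ac)
qed simp

text \<open>
  Each box falls into one of three categories: ``low'' with probability \<open>u\<close>, ``ordinary'' with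
  probability \<open>v\<close>, and ``high'' with the remaining probability. If the expected numbers of low and high
  boxes are close to \<open>\<alpha>\<close> and \<open>\<mu> n\<close>, the probability of at most \<open>l\<close> low boxes and no high box
  factorizes in the limit as for independent Poisson variables.
\<close>

lemma trinomial_to_poisson:
  fixes u v \<mu> :: "nat \<Rightarrow> real"
  assumes u: "(\<lambda>n. real n * u n) \<longlonglongrightarrow> \<alpha>" and "0 \<le> \<alpha>"
    and v: "\<And>n. 0 \<le> v n" "\<And>n. v n \<le> 1"
    and \<mu>: "\<And>n. 0 \<le> \<mu> n" "Bseq \<mu>"
    and lim: "(\<lambda>n. real n * (1 - v n) - (\<alpha> + \<mu> n)) \<longlonglongrightarrow> 0"
  shows "(\<lambda>n. (\<Sum>r\<le>l. real (n choose r) * u n ^ r * v n ^ (n - r)) -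
      (\<Sum>r\<le>l. \<alpha> ^ r / fact r) * exp (- \<alpha>) * exp (- \<mu> n)) \<longlonglongrightarrow> 0"
proof -
  obtain K where K: "\<And>n. norm (\<mu> n) \<le> K"
    using \<mu>(2) by (auto simp: Bseq_def)
  have B: "Bseq (\<lambda>n. \<alpha> + \<mu> n)"
  proof (rule BseqI'[of _ "\<alpha> + K"])
    show "norm (\<alpha> + \<mu> n) \<le> \<alpha> + K" for n
      using K[of n] \<open>0 \<le> \<alpha>\<close> by (simp add: abs_if split: if_splits)
  qed
  have v1: "v \<longlonglongrightarrow> 1"
  proof -
    have "(\<lambda>n. 1 - ((real n * (1 - v n) - (\<alpha> + \<mu> n)) / real n + (\<alpha> + \<mu> n) / real n)) \<longlonglongrightarrow> 1 - (0 + 0)"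
    proof (intro tendsto_intros real_tendsto_divide_at_top[OF lim filterlim_real_sequentially])
      show "(\<lambda>n. (\<alpha> + \<mu> n) / real n) \<longlonglongrightarrow> 0"
        by (rule bounded_over_diverging[OF B filterlim_real_sequentially])
    qed
    moreover have "eventually (\<lambda>n. 1 - ((real n * (1 - v n) - (\<alpha> + \<mu> n)) / real n + (\<alpha> + \<mu> n) / real n) = v n) sequentially"
      using eventually_gt_at_top[of 0] by eventually_elim (simp add: field_simps)
    ultimately show ?thesis
      using Lim_transform_eventually by force
  qed
  have W: "(\<lambda>n. v n ^ (n - r) - exp (- \<alpha>) * exp (- \<mu> n)) \<longlonglongrightarrow> 0" for r
  proof -
    have "(\<lambda>n. v n ^ (n - r) - v n ^ n) \<longlonglongrightarrow> 0"
    proof (rule Lim_null_comparison)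
      show "eventually (\<lambda>n. norm (v n ^ (n - r) - v n ^ n) \<le> 1 - v n ^ r) sequentially"
        using eventually_ge_at_top[of r]
      proof eventually_elim
        case (elim n)
        have "v n ^ n = v n ^ (n - r) * v n ^ r"
          using elim by (simp flip: power_add)
        then have "v n ^ (n - r) - v n ^ n = v n ^ (n - r) * (1 - v n ^ r)"
          by (simp add: algebra_simps)
        moreover have "v n ^ (n - r) * (1 - v n ^ r) \<le> 1 * (1 - v n ^ r)"
          by (intro mult_right_mono) (auto simp: power_le_one v)
        ultimately show ?case
          using v by (simp add: power_le_one)
      qed
      have "(\<lambda>n. 1 - v n ^ r) \<longlonglongrightarrow> 1 - 1 ^ r"
        by (intro tendsto_intros v1)
      then show "(\<lambda>n. 1 - v n ^ r) \<longlonglongrightarrow> 0" by simp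
    qed
    from tendsto_add[OF this power_minus_exp_tendsto_0[OF v _ B lim]]
    show ?thesis
      using \<open>0 \<le> \<alpha>\<close> \<mu>(1) by (simp add: exp_add[symmetric])
  qed
  have T: "(\<lambda>n. (real (n choose r) * u n ^ r) * v n ^ (n - r) -
      \<alpha> ^ r / fact r * (exp (- \<alpha>) * exp (- \<mu> n))) \<longlonglongrightarrow> 0" for r
  proof -
    have "(\<lambda>n. (real (n choose r) * u n ^ r) * (v n ^ (n - r) - exp (- \<alpha>) * exp (- \<mu> n)) +
      (real (n choose r) * u n ^ r - \<alpha> ^ r / fact r) * (exp (- \<alpha>) * exp (- \<mu> n))) \<longlonglongrightarrow> \<alpha> ^ r / fact r * 0 + 0"
    proof (intro tendsto_add tendsto_mult choose_times_power_tendsto u W)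
      show "(\<lambda>n. (real (n choose r) * u n ^ r - \<alpha> ^ r / fact r) * (exp (- \<alpha>) * exp (- \<mu> n))) \<longlonglongrightarrow> 0"
      proof (rule Lim_null_comparison)
        show "eventually (\<lambda>n. norm ((real (n choose r) * u n ^ r - \<alpha> ^ r / fact r) * (exp (- \<alpha>) * exp (- \<mu> n)))
            \<le> norm (real (n choose r) * u n ^ r - \<alpha> ^ r / fact r)) sequentially"
        proof (intro always_eventually allI)
          fix n
          have "norm (exp (- \<alpha>) * exp (- \<mu> n)) \<le> 1"
            using \<open>0 \<le> \<alpha>\<close> \<mu>(1)[of n] by (simp flip: exp_add)
          then show "norm ((real (n choose r) * u n ^ r - \<alpha> ^ r / fact r) * (exp (- \<alpha>) * exp (- \<mu> n)))
            \<le> norm (real (n choose r) * u n ^ r - \<alpha> ^ r / fact r)"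
            unfolding norm_mult[of _ "exp (- \<alpha>) * exp (- \<mu> n)"] by (intro mult_left_le) auto
        qed
        show "(\<lambda>n. norm (real (n choose r) * u n ^ r - \<alpha> ^ r / fact r)) \<longlonglongrightarrow> 0"
          by (intro tendsto_norm_zero LIM_zero choose_times_power_tendsto u)
      qed
    qed
    then show ?thesis
      by (simp add: algebra_simps)
  qed
  have "(\<lambda>n. \<Sum>r\<le>l. (real (n choose r) * u n ^ r) * v n ^ (n - r) -
      \<alpha> ^ r / fact r * (exp (- \<alpha>) * exp (- \<mu> n))) \<longlonglongrightarrow> (\<Sum>r\<le>l. 0)"
    by (intro tendsto_sum T)
  then show ?thesis
    by (simp add: sum_subtractf sum_distrib_right mult.assoc)
qed

text \<open>
  The event is partitioned by the set \<open>J\<close> of indices with value 1; independence gives every \<open>J\<close> of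
  size \<open>r\<close> the weight \<open>u^r v^(n - r)\<close>.
\<close>

lemma (in prob_space) prob_card_le:
  fixes X :: "'i \<Rightarrow> 'a \<Rightarrow> nat"
  assumes I: "finite I" "I \<noteq> {}"
    and indep: "indep_vars (\<lambda>_. count_space UNIV) X I"
    and u: "\<And>i. i \<in> I \<Longrightarrow> prob (X i -` {1} \<inter> space M) = u"
    and v: "\<And>i. i \<in> I \<Longrightarrow> prob (X i -` {0} \<inter> space M) = v"
  shows "prob {\<omega> \<in> space M. (\<forall>i\<in>I. X i \<omega> \<le> 1) \<and> card {i \<in> I. X i \<omega> = 1} \<le> l} =
    (\<Sum>r\<le>l. real (card I choose r) * u ^ r * v ^ (card I - r))"
proof -
  define E where "E J = (\<Inter>i\<in>I. X i -` {if i \<in> J then 1 else 0} \<inter> space M)" for J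
  have rv: "X i \<in> measurable M (count_space UNIV)" if "i \<in> I" for i
    using indep that by (simp add: indep_vars_def2)
  have E_sets: "E J \<in> events" for J
    unfolding E_def using I rv by (intro sets.finite_INT measurable_sets) auto
  have E_prob: "prob (E J) = u ^ card J * v ^ (card I - card J)" if J: "J \<subseteq> I" for J
  proof -
    have "prob (E J) = (\<Prod>i\<in>I. prob (X i -` {if i \<in> J then 1 else 0} \<inter> space M))"
      unfolding E_def using I indep by (intro indep_varsD[OF indep]) auto
    also have "\<dots> = (\<Prod>i\<in>I. if i \<in> J then u else v)"
      using u v by (intro prod.cong) auto
    also have "\<dots> = u ^ card (I \<inter> J) * v ^ card (I - J)"
      using I by (simp add: prod.If_cases Diff_eq)
    also have "I \<inter> J = J"
      using J by auto
    also have "card (I - J) = card I - card J"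
      using I J by (simp add: card_Diff_subset finite_subset)
    finally show ?thesis .
  qed
  have E_iff: "\<omega> \<in> E J \<longleftrightarrow> \<omega> \<in> space M \<and> (\<forall>i\<in>I. X i \<omega> \<le> 1) \<and> {i \<in> I. X i \<omega> = 1} = J"
    if "J \<subseteq> I" for J \<omega>
    using that I(2) unfolding E_def by (auto split: if_splits simp: le_Suc_eq)
  let ?T = "{J. J \<subseteq> I \<and> card J \<le> l}"
  have fin: "finite ?T"
    using I by simp
  have "{\<omega> \<in> space M. (\<forall>i\<in>I. X i \<omega> \<le> 1) \<and> card {i \<in> I. X i \<omega> = 1} \<le> l} = (\<Union>J\<in>?T. E J)"
  proof (intro equalityI subsetI)
    fix \<omega> assume "\<omega> \<in> {\<omega> \<in> space M. (\<forall>i\<in>I. X i \<omega> \<le> 1) \<and> card {i \<in> I. X i \<omega> = 1} \<le> l}"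
    then show "\<omega> \<in> (\<Union>J\<in>?T. E J)"
      by (intro UN_I[of "{i \<in> I. X i \<omega> = 1}"]) (auto simp: E_iff)
  next
    fix \<omega> assume "\<omega> \<in> (\<Union>J\<in>?T. E J)"
    then obtain J where "J \<subseteq> I" "card J \<le> l" "\<omega> \<in> E J" by auto
    then show "\<omega> \<in> {\<omega> \<in> space M. (\<forall>i\<in>I. X i \<omega> \<le> 1) \<and> card {i \<in> I. X i \<omega> = 1} \<le> l}"
      using E_iff[of J \<omega>] by auto
  qed
  also have "prob (\<Union>J\<in>?T. E J) = (\<Sum>J\<in>?T. prob (E J))"
  proof (rule finite_measure_finite_Union[OF fin])
    show "disjoint_family_on E ?T"
      by (auto simp: disjoint_family_on_def E_iff)
  qed (use E_sets in auto)
  also have "\<dots> = (\<Sum>J\<in>?T. u ^ card J * v ^ (card I - card J))"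
    by (intro sum.cong) (auto simp: E_prob)
  also have "\<dots> = (\<Sum>r\<le>l. \<Sum>J\<in>{J\<in>?T. card J = r}. u ^ card J * v ^ (card I - card J))"
    by (rule sum.group[symmetric]) (use fin in auto)
  also have "\<dots> = (\<Sum>r\<le>l. real (card I choose r) * u ^ r * v ^ (card I - r))"
  proof (rule sum.cong[OF refl])
    fix r assume "r \<in> {..l}"
    then have "{J\<in>?T. card J = r} = {J. J \<subseteq> I \<and> card J = r}"
      by auto
    then show "(\<Sum>J\<in>{J\<in>?T. card J = r}. u ^ card J * v ^ (card I - card J)) =
        real (card I choose r) * u ^ r * v ^ (card I - r)"
      using I by (simp add: n_subsets)
  qed
  finally show ?thesis .
qed

text \<open>
  The predicate \<open>K\<close> is either ``at most \<open>k\<close> balls'', for joint probabilities, or trivial, for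
  the law of the stopping time.
\<close>

lemma prob_stopped_by_and:
  assumes N: "iid_unit_poisson_processes P N" and n: "n \<ge> 1" and s: "0 \<le> s" and t: "0 \<le> t"
    and u: "\<And>i. i \<ge> 1 \<Longrightarrow> measure P {\<omega> \<in> space P. N i s \<omega> \<le> m \<and> K (N i t \<omega>)} = u"
    and v: "\<And>i. i \<ge> 1 \<Longrightarrow> measure P {\<omega> \<in> space P. m < N i s \<omega> \<and> K (N i t \<omega>)} = v"
  shows "measure P {\<omega> \<in> space P. s \<in> stopping_set m l N n \<omega> \<and> (\<forall>i\<in>{1..n}. K (N i t \<omega>))} =
    (\<Sum>r\<le>l. real (n choose r) * u ^ r * v ^ (n - r))"
proof -
  interpret prob_space P
    using N by (simp add: iid_unit_poisson_processes_def)
  define Y where "Y f = (if \<not> K (f t) then 2 else if f s \<le> m then 1 else 0 :: nat)" for f :: "real \<Rightarrow> nat"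
  define X where "X i \<omega> = Y (\<lambda>r\<in>{0..}. N i r \<omega>)" for i \<omega>
  have X: "X i \<omega> = (if \<not> K (N i t \<omega>) then 2 else if N i s \<omega> \<le> m then 1 else 0)" for i \<omega>
    using s t by (simp add: X_def Y_def)
  have "indep_vars (\<lambda>_. PiM {0..} (\<lambda>_. count_space UNIV)) (\<lambda>i \<omega>. \<lambda>t\<in>{0..}. N i t \<omega>) {1..n}"
    using N by (auto simp: iid_unit_poisson_processes_def intro: indep_vars_subset)
  then have indep: "indep_vars (\<lambda>_. count_space UNIV) X {1..n}"
    unfolding X_def[abs_def]
  proof (rule indep_vars_compose2)
    have [measurable]: "(\<lambda>f. f r) \<in> measurable (PiM {0..} (\<lambda>_. count_space UNIV)) (count_space (UNIV :: nat set))"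
      if "0 \<le> r" for r :: real
      using that by (intro measurable_component_singleton) auto
    note [measurable] = this[OF s] this[OF t]
    show "Y \<in> measurable (PiM {0..} (\<lambda>_. count_space UNIV)) (count_space UNIV)"
      unfolding Y_def[abs_def] by measurable
  qed
  have "X i -` {1} \<inter> space P = {\<omega> \<in> space P. N i s \<omega> \<le> m \<and> K (N i t \<omega>)}"
    and "X i -` {0} \<inter> space P = {\<omega> \<in> space P. m < N i s \<omega> \<and> K (N i t \<omega>)}" for i
    by (auto simp: X split: if_splits)
  then have "prob {\<omega> \<in> space P. (\<forall>i\<in>{1..n}. X i \<omega> \<le> 1) \<and> card {i \<in> {1..n}. X i \<omega> = 1} \<le> l} =
    (\<Sum>r\<le>l. real (card {1..n} choose r) * u ^ r * v ^ (card {1..n} - r))"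
    using n u v by (intro prob_card_le indep) auto
  also have "{\<omega> \<in> space P. (\<forall>i\<in>{1..n}. X i \<omega> \<le> 1) \<and> card {i \<in> {1..n}. X i \<omega> = 1} \<le> l} =
    {\<omega> \<in> space P. s \<in> stopping_set m l N n \<omega> \<and> (\<forall>i\<in>{1..n}. K (N i t \<omega>))}"
  proof (rule Collect_cong)
    fix \<omega>
    have a: "(\<forall>i\<in>{1..n}. X i \<omega> \<le> 1) \<longleftrightarrow> (\<forall>i\<in>{1..n}. K (N i t \<omega>))"
      by (auto simp: X)
    moreover have "{i \<in> {1..n}. X i \<omega> = 1} = {i \<in> {1..n}. \<not> N i s \<omega> > m}" if "\<forall>i\<in>{1..n}. K (N i t \<omega>)"
      using that by (auto simp: X split: if_splits)
    ultimately show "(\<omega> \<in> space P \<and> (\<forall>i\<in>{1..n}. X i \<omega> \<le> 1) \<and> card {i \<in> {1..n}. X i \<omega> = 1} \<le> l) =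
        (\<omega> \<in> space P \<and> s \<in> stopping_set m l N n \<omega> \<and> (\<forall>i\<in>{1..n}. K (N i t \<omega>)))"
      using s unfolding stopping_set_def by auto
  qed
  finally show ?thesis
    by simp
qed

section \<open>One box at two times\<close>

text \<open>
  The probability that a unit-rate Poisson process is at most \<open>m\<close> at time \<open>s\<close> and exceeds \<open>k \<ge> m\<close> at
  time \<open>t\<close>. An explicit formula makes evident that it is the same for all boxes.
\<close>

definition low_high_prob :: "nat \<Rightarrow> nat \<Rightarrow> real \<Rightarrow> real \<Rightarrow> real" where
  "low_high_prob m k s t = (if s < t then
     \<Sum>a\<le>m. pmf (poisson_pmf s) a * measure (measure_pmf (poisson_pmf (t - s))) {k - a<..} else 0)"

text \<open>
  A box that goes from at most \<open>m\<close> to more than \<open>k\<close> gains more than \<open>k - m\<close> balls between the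
  two times, independently of the past.
\<close>

lemma low_high_prob_bounds:
  assumes "0 < s"
  shows "0 \<le> low_high_prob m k s t"
    and "low_high_prob m k s t \<le> measure (measure_pmf (poisson_pmf s)) {..m} *
      (if s < t then measure (measure_pmf (poisson_pmf (t - s))) {k - m<..} else 0)"
proof -
  show "0 \<le> low_high_prob m k s t"
    unfolding low_high_prob_def by (auto intro!: sum_nonneg mult_nonneg_nonneg simp del: pmf_poisson)
  have "(\<Sum>a\<le>m. pmf (poisson_pmf s) a * measure (measure_pmf (poisson_pmf (t - s))) {k - a<..})
      \<le> (\<Sum>a\<le>m. pmf (poisson_pmf s) a * measure (measure_pmf (poisson_pmf (t - s))) {k - m<..})"
    by (intro sum_mono mult_left_mono measure_pmf.finite_measure_mono pmf_nonneg) auto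
  also have "\<dots> = measure (measure_pmf (poisson_pmf s)) {..m} * measure (measure_pmf (poisson_pmf (t - s))) {k - m<..}"
    by (simp only: measure_measure_pmf_finite[OF finite_atMost] sum_distrib_right)
  finally show "low_high_prob m k s t \<le> measure (measure_pmf (poisson_pmf s)) {..m} *
      (if s < t then measure (measure_pmf (poisson_pmf (t - s))) {k - m<..} else 0)"
    by (simp add: low_high_prob_def del: pmf_poisson)
qed

context unit_poisson_process
begin

lemma prob_increment:
  assumes "0 \<le> s" "s < t"
  shows "prob ((\<lambda>\<omega>. N t \<omega> - N s \<omega>) -` A \<inter> space M) = measure (measure_pmf (poisson_pmf (t - s))) A"
proof -
  have [measurable]: "N t \<in> measurable M (count_space UNIV)" "N s \<in> measurable M (count_space UNIV)"
    using assms by (auto intro: measurable_process)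
  show ?thesis
    unfolding poisson_increments[OF assms, symmetric] by (subst measure_distr) auto
qed

lemma prob_process:
  assumes "0 < t"
  shows "prob {\<omega> \<in> space M. N t \<omega> \<in> A} = measure (measure_pmf (poisson_pmf t)) A"
proof -
  have "{\<omega> \<in> space M. N t \<omega> \<in> A} = (\<lambda>\<omega>. N t \<omega> - N 0 \<omega>) -` A \<inter> space M"
    by (auto simp: start_zero)
  then show ?thesis
    using prob_increment[of 0 t A] assms by simp
qed

text \<open>
  For \<open>s < t\<close> the event splits according to the count \<open>a\<close> at time \<open>s\<close>, and the two increments are
  independent; otherwise monotonicity makes it impossible.
\<close>

lemma prob_low_high:
  assumes "0 < s" "0 < t" "m \<le> k"
  shows "prob {\<omega> \<in> space M. N s \<omega> \<le> m \<and> k < N t \<omega>} = low_high_prob m k s t"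
proof (cases "s < t")
  case False
  have "N t \<omega> \<le> N s \<omega>" if "\<omega> \<in> space M" for \<omega>
    using False assms that by (intro nondecreasing) auto
  then have empty: "{\<omega> \<in> space M. N s \<omega> \<le> m \<and> k < N t \<omega>} = {}"
    using \<open>m \<le> k\<close> by fastforce
  show ?thesis
    unfolding empty using False by (simp add: low_high_prob_def)
next
  case True
  \<comment> \<open>The two increments over \<open>0 < s < t\<close>, indexed as \<open>independent_increments\<close> expects.\<close>
  define X where "X j \<omega> = N ([0, s, t] ! Suc j) \<omega> - N ([0, s, t] ! j) \<omega>" for j \<omega>
  have indep: "indep_vars (\<lambda>_. count_space UNIV) X {..<2}"
    unfolding X_def[abs_def]
  proof (rule independent_increments)
    fix j :: nat assume "j < 2"
    then show "[0, s, t] ! j < [0, s, t] ! Suc j"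
      using True assms by (auto simp: less_2_cases_iff)
  qed simp
  have X0: "X 0 \<omega> = N s \<omega> - N 0 \<omega>" and X1: "X 1 \<omega> = N t \<omega> - N s \<omega>" for \<omega>
    by (auto simp: X_def)
  have two: "{..<2} = {0, 1::nat}"
    by auto
  define E where "E a = (\<Inter>j\<in>{..<2}. X j -` (if j = 0 then {a} else {k - a<..}) \<inter> space M)" for a
  have E_prob: "prob (E a) = pmf (poisson_pmf s) a * measure (measure_pmf (poisson_pmf (t - s))) {k - a<..}" for a
  proof -
    have "prob (E a) = (\<Prod>j\<in>{..<2}. prob (X j -` (if j = 0 then {a} else {k - a<..}) \<inter> space M))"
      unfolding E_def by (rule indep_varsD[OF indep]) (auto simp: two)
    also have "\<dots> = prob (X 0 -` {a} \<inter> space M) * prob (X 1 -` {k - a<..} \<inter> space M)"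
      unfolding two by simp
    also have "X 0 -` {a} \<inter> space M = (\<lambda>\<omega>. N s \<omega> - N 0 \<omega>) -` {a} \<inter> space M"
      by (auto simp: X0)
    also have "prob \<dots> = pmf (poisson_pmf (s - 0)) a"
      using assms by (subst prob_increment) (auto simp: measure_pmf_single simp del: pmf_poisson)
    also have "X 1 -` {k - a<..} \<inter> space M = (\<lambda>\<omega>. N t \<omega> - N s \<omega>) -` {k - a<..} \<inter> space M"
      by (auto simp: X1[simplified])
    also have "prob \<dots> = measure (measure_pmf (poisson_pmf (t - s))) {k - a<..}"
      using True assms by (intro prob_increment) auto
    finally show ?thesis by (simp del: pmf_poisson)
  qed
  have E_iff: "\<omega> \<in> E a \<longleftrightarrow> \<omega> \<in> space M \<and> N s \<omega> = a \<and> k - a < N t \<omega> - N s \<omega>" for a \<omega>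
    unfolding E_def two by (auto simp: X0 X1[simplified] start_zero)
  have E_sets: "E a \<in> events" for a
    unfolding E_def using indep by (intro sets.finite_INT measurable_sets) (auto simp: indep_vars_def2 two)
  have "{\<omega> \<in> space M. N s \<omega> \<le> m \<and> k < N t \<omega>} = (\<Union>a\<in>{..m}. E a)"
    using \<open>m \<le> k\<close> by (auto simp: E_iff)
  also have "prob \<dots> = (\<Sum>a\<le>m. prob (E a))"
    by (intro finite_measure_finite_Union) (use E_sets in \<open>auto simp: disjoint_family_on_def E_iff\<close>)
  finally show ?thesis
    using True by (simp add: E_prob low_high_prob_def del: pmf_poisson)
qed

lemma prob_box_categories:
  assumes "0 < s" "0 < t" "m \<le> k"
  shows "prob {\<omega> \<in> space M. N s \<omega> \<le> m \<and> N t \<omega> \<le> k} =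
      measure (measure_pmf (poisson_pmf s)) {..m} - low_high_prob m k s t" (is "prob ?U = _")
    and "prob {\<omega> \<in> space M. m < N s \<omega> \<and> N t \<omega> \<le> k} =
      1 - measure (measure_pmf (poisson_pmf s)) {..m} - measure (measure_pmf (poisson_pmf t)) {k<..}
      + low_high_prob m k s t" (is "prob ?V = _")
proof -
  have [measurable]: "N t \<in> measurable M (count_space UNIV)" "N s \<in> measurable M (count_space UNIV)"
    using assms by (auto intro: measurable_process)
  have "prob {\<omega> \<in> space M. N s \<omega> \<in> {..m}} = prob ?U + prob {\<omega> \<in> space M. N s \<omega> \<le> m \<and> k < N t \<omega>}"
    by (subst finite_measure_Union[symmetric]) (auto intro!: arg_cong[where f = prob])
  then show U: "prob ?U = measure (measure_pmf (poisson_pmf s)) {..m} - low_high_prob m k s t"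
    using assms by (simp only: prob_process prob_low_high)
  have "prob {\<omega> \<in> space M. N t \<omega> \<in> {..k}} = prob ?U + prob ?V"
    by (subst finite_measure_Union[symmetric]) (auto intro!: arg_cong[where f = prob])
  moreover have "measure (measure_pmf (poisson_pmf t)) {..k} = 1 - measure (measure_pmf (poisson_pmf t)) {k<..}"
    using measure_pmf.prob_compl[of "{k<..}" "poisson_pmf t"] by (simp add: Compl_eq_Diff_UNIV[symmetric])
  ultimately show "prob ?V = 1 - measure (measure_pmf (poisson_pmf s)) {..m} - measure (measure_pmf (poisson_pmf t)) {k<..}
      + low_high_prob m k s t"
    using U assms by (simp only: prob_process)
qed

end

section \<open>The stopping time and the stopped maximum along a path\<close>

context
  fixes m l n :: nat and N :: "nat \<Rightarrow> real \<Rightarrow> 'a \<Rightarrow> nat" and \<omega> :: 'a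
  assumes mono: "\<And>i s t. i \<in> {1..n} \<Longrightarrow> 0 \<le> s \<Longrightarrow> s \<le> t \<Longrightarrow> N i s \<omega> \<le> N i t \<omega>"
    and right_cont: "\<And>i t. i \<in> {1..n} \<Longrightarrow> 0 \<le> t \<Longrightarrow> continuous (at_right t) (\<lambda>s. N i s \<omega>)"
begin

lemma stopping_set_upward_closed:
  assumes "s \<in> stopping_set m l N n \<omega>" and "s \<le> t"
  shows "t \<in> stopping_set m l N n \<omega>"
proof -
  have le: "N i s \<omega> \<le> N i t \<omega>" if "i \<in> {1..n}" for i
    using assms that by (intro mono) (auto simp: stopping_set_def)
  have "{i \<in> {1..n}. \<not> N i t \<omega> > m} \<subseteq> {i \<in> {1..n}. \<not> N i s \<omega> > m}"
  proof
    fix i assume "i \<in> {i \<in> {1..n}. \<not> N i t \<omega> > m}"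
    then show "i \<in> {i \<in> {1..n}. \<not> N i s \<omega> > m}"
      using le[of i] by auto
  qed
  then have "card {i \<in> {1..n}. \<not> N i t \<omega> > m} \<le> card {i \<in> {1..n}. \<not> N i s \<omega> > m}"
    by (intro card_mono) auto
  then show ?thesis
    using assms by (auto simp: stopping_set_def)
qed

text \<open>
  A right-continuous function with values in a discrete space is constant on a right
  neighbourhood; finitely many boxes share one such neighbourhood.
\<close>

lemma locally_constant_on_right:
  assumes "0 \<le> t"
  obtains u where "u > t" and "\<And>i s. i \<in> {1..n} \<Longrightarrow> t \<le> s \<Longrightarrow> s < u \<Longrightarrow> N i s \<omega> = N i t \<omega>"
proof -
  have "eventually (\<lambda>s. N i s \<omega> = N i t \<omega>) (at_right t)" if "i \<in> {1..n}" for i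
    using right_cont[OF that assms] by (simp add: continuous_within tendsto_discrete)
  then have "eventually (\<lambda>s. \<forall>i\<in>{1..n}. N i s \<omega> = N i t \<omega>) (at_right t)"
    by (intro eventually_ball_finite) auto
  then obtain u where u: "u > t" "\<And>s. t < s \<Longrightarrow> s < u \<Longrightarrow> \<forall>i\<in>{1..n}. N i s \<omega> = N i t \<omega>"
    by (auto simp: eventually_at_right_field)
  show thesis
  proof (rule that[OF u(1)])
    fix i s assume "i \<in> {1..n}" "t \<le> s" "s < u"
    with u(2)[of s] show "N i s \<omega> = N i t \<omega>"
      by (cases "s = t") auto
  qed
qed

text \<open>
  The infimum of the stopping set belongs to it: all boxes keep their values from the infimum up to
  some element of the set.
\<close>

lemma stopping_time_least:
  assumes "stopping_set m l N n \<omega> \<noteq> {}"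
  shows stopping_time_in_stopping_set: "stopping_time m l N n \<omega> \<in> stopping_set m l N n \<omega>"
    and stopping_time_le: "t \<in> stopping_set m l N n \<omega> \<Longrightarrow> stopping_time m l N n \<omega> \<le> t"
proof -
  let ?S = "stopping_set m l N n \<omega>"
  have bdd: "bdd_below ?S"
    by (rule bdd_belowI[of _ 0]) (auto simp: stopping_set_def)
  have T0: "0 \<le> Inf ?S"
    using assms by (intro cInf_greatest) (auto simp: stopping_set_def)
  obtain u where u: "u > Inf ?S" "\<And>i s. i \<in> {1..n} \<Longrightarrow> Inf ?S \<le> s \<Longrightarrow> s < u \<Longrightarrow> N i s \<omega> = N i (Inf ?S) \<omega>"
    using locally_constant_on_right[OF T0] by metis
  obtain s where s: "s \<in> ?S" "s < u"
    using u(1) assms bdd by (auto simp: cInf_less_iff)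
  have "Inf ?S \<le> s"
    using s bdd by (intro cInf_lower)
  then have "N i s \<omega> = N i (Inf ?S) \<omega>" if "i \<in> {1..n}" for i
    by (intro u(2) that s(2))
  then have "{i \<in> {1..n}. \<not> N i (Inf ?S) \<omega> > m} = {i \<in> {1..n}. \<not> N i s \<omega> > m}"
    by (intro Collect_cong conj_cong) simp_all
  with s(1) T0 have In: "Inf ?S \<in> ?S"
    by (auto simp: stopping_set_def)
  have lower: "Inf ?S \<le> t" if "t \<in> ?S" for t
    using that bdd by (intro cInf_lower)
  have "stopping_time m l N n \<omega> = Inf ?S"
    using assms In lower by (simp add: stopping_time_def Least_equality)
  with In lower show "stopping_time m l N n \<omega> \<in> ?S" "t \<in> ?S \<Longrightarrow> stopping_time m l N n \<omega> \<le> t"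
    by auto
qed

lemma stopped_max_le:
  assumes "n \<ge> 1" and t: "t \<in> stopping_set m l N n \<omega>" and "\<And>i. i \<in> {1..n} \<Longrightarrow> N i t \<omega> \<le> k"
  shows "stopped_max m l N n \<omega> \<le> k"
proof -
  have ne: "stopping_set m l N n \<omega> \<noteq> {}"
    using t by auto
  have "N i (stopping_time m l N n \<omega>) \<omega> \<le> k" if "i \<in> {1..n}" for i
    using mono[OF that _ stopping_time_le[OF ne t]] stopping_time_in_stopping_set[OF ne] assms(3)[OF that]
    by (auto simp: stopping_set_def)
  then show ?thesis
    using \<open>n \<ge> 1\<close> unfolding stopped_max_def by (subst Max_le_iff) auto
qed

text \<open>
  Together with \<open>stopped_max_le\<close> this turns statements about the maximum at the random stopping time
  into statements about fixed times: a time that has stopped bounds the maximum from above, a time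
  that has not stopped yet bounds it from below.
\<close>

lemma stopped_max_leD:
  assumes ne: "stopping_set m l N n \<omega> \<noteq> {}" and k: "stopped_max m l N n \<omega> \<le> k"
    and t: "0 \<le> t" "t \<notin> stopping_set m l N n \<omega>" and i: "i \<in> {1..n}"
  shows "N i t \<omega> \<le> k"
proof -
  have "t \<le> stopping_time m l N n \<omega>"
    using stopping_set_upward_closed[OF stopping_time_in_stopping_set[OF ne], of t] t(2) by linarith
  then have "N i t \<omega> \<le> N i (stopping_time m l N n \<omega>) \<omega>"
    using i t(1) by (intro mono)
  also have "\<dots> \<le> stopped_max m l N n \<omega>"
    unfolding stopped_max_def using i by (intro Max_ge) auto
  finally show ?thesis
    using k by simp
qed

lemma stopping_set_nonempty_iff_rat:
  "stopping_set m l N n \<omega> \<noteq> {} \<longleftrightarrow> (\<exists>q\<in>\<rat> \<inter> {0..}. q \<in> stopping_set m l N n \<omega>)"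
proof
  assume "stopping_set m l N n \<omega> \<noteq> {}"
  then obtain t where t: "t \<in> stopping_set m l N n \<omega>" by auto
  obtain q where "q \<in> \<rat>" "t < q"
    using Rats_dense_in_real[of t "t + 1"] by auto
  with stopping_set_upward_closed[OF t, of q] show "\<exists>q\<in>\<rat> \<inter> {0..}. q \<in> stopping_set m l N n \<omega>"
    by (auto simp: stopping_set_def)
qed auto

text \<open>
  Just after the stopping time the boxes have not changed, so a rational time can replace it. This
  writes the event as a countable union.
\<close>

lemma stopped_max_le_iff_rat:
  assumes "n \<ge> 1" and ne: "stopping_set m l N n \<omega> \<noteq> {}"
  shows "stopped_max m l N n \<omega> \<le> k \<longleftrightarrow>
    (\<exists>q\<in>\<rat> \<inter> {0..}. q \<in> stopping_set m l N n \<omega> \<and> (\<forall>i\<in>{1..n}. N i q \<omega> \<le> k))"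
proof
  assume k: "stopped_max m l N n \<omega> \<le> k"
  let ?T = "stopping_time m l N n \<omega>"
  note T = stopping_time_in_stopping_set[OF ne]
  then have T0: "0 \<le> ?T"
    by (auto simp: stopping_set_def)
  obtain u where u: "u > ?T" "\<And>i s. i \<in> {1..n} \<Longrightarrow> ?T \<le> s \<Longrightarrow> s < u \<Longrightarrow> N i s \<omega> = N i ?T \<omega>"
    using locally_constant_on_right[OF T0] by metis
  obtain q where q: "q \<in> \<rat>" "?T < q" "q < u"
    using Rats_dense_in_real[OF u(1)] by auto
  have "N i q \<omega> \<le> k" if "i \<in> {1..n}" for i
  proof -
    have "N i q \<omega> = N i ?T \<omega>"
      by (rule u(2)[OF that]) (use q in auto)
    also have "\<dots> \<le> stopped_max m l N n \<omega>"
      unfolding stopped_max_def using that by (intro Max_ge) auto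
    finally show ?thesis
      using k by simp
  qed
  then show "\<exists>q\<in>\<rat> \<inter> {0..}. q \<in> stopping_set m l N n \<omega> \<and> (\<forall>i\<in>{1..n}. N i q \<omega> \<le> k)"
    using q T0 stopping_set_upward_closed[OF T, of q] by (intro bexI[of _ q]) auto
qed (use stopped_max_le[OF \<open>n \<ge> 1\<close>] in blast)

end

lemma iid_unit_poisson_processes_path:
  assumes "iid_unit_poisson_processes P N" and "\<omega> \<in> space P"
  shows "i \<in> {1..n} \<Longrightarrow> 0 \<le> s \<Longrightarrow> s \<le> t \<Longrightarrow> N i s \<omega> \<le> N i t \<omega>"
    and "i \<in> {1..n} \<Longrightarrow> 0 \<le> t \<Longrightarrow> continuous (at_right t) (\<lambda>s. N i s \<omega>)"
proof -
  have "unit_poisson_process P (N i)" if "i \<in> {1..n}"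
    using assms(1) that by (auto simp: iid_unit_poisson_processes_def)
  with assms(2) show "i \<in> {1..n} \<Longrightarrow> 0 \<le> s \<Longrightarrow> s \<le> t \<Longrightarrow> N i s \<omega> \<le> N i t \<omega>"
    and "i \<in> {1..n} \<Longrightarrow> 0 \<le> t \<Longrightarrow> continuous (at_right t) (\<lambda>s. N i s \<omega>)"
    by (auto intro: unit_poisson_process.nondecreasing unit_poisson_process.right_continuous)
qed

lemma measurable_box_count:
  assumes "iid_unit_poisson_processes P N" and "i \<in> {1..n}" and "0 \<le> t"
  shows "N i t \<in> measurable P (count_space UNIV)"
  using assms by (auto simp: iid_unit_poisson_processes_def intro: unit_poisson_process.measurable_process)

lemma sets_stopped_by:
  assumes "iid_unit_poisson_processes P N" and "0 \<le> t"
  shows "{\<omega> \<in> space P. t \<in> stopping_set m l N n \<omega>} \<in> sets P"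
proof -
  have "(\<lambda>\<omega>. card {i \<in> {1..n}. \<not> N i t \<omega> > m}) \<in> measurable P (count_space UNIV)"
  proof (rule measurable_card)
    fix i
    show "{\<omega> \<in> space P. i \<in> {i \<in> {1..n}. \<not> N i t \<omega> > m}} \<in> sets P"
    proof (cases "i \<in> {1..n}")
      case True
      note [measurable] = measurable_box_count[OF assms(1) True assms(2)]
      have "{\<omega> \<in> space P. \<not> N i t \<omega> > m} \<in> sets P"
        by measurable
      with True show ?thesis by simp
    next
      case False
      then have "{\<omega> \<in> space P. i \<in> {i \<in> {1..n}. \<not> N i t \<omega> > m}} = {}" by auto
      then show ?thesis by (simp only: sets.empty_sets)
    qed
  qed
  then have "{\<omega> \<in> space P. card {i \<in> {1..n}. \<not> N i t \<omega> > m} \<le> l} \<in> sets P"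
    by measurable
  also have "{\<omega> \<in> space P. card {i \<in> {1..n}. \<not> N i t \<omega> > m} \<le> l} =
      {\<omega> \<in> space P. t \<in> stopping_set m l N n \<omega>}"
    unfolding stopping_set_def using assms(2) by blast
  finally show ?thesis .
qed

lemma sets_all_boxes_le:
  assumes "iid_unit_poisson_processes P N" and "0 \<le> t"
  shows "{\<omega> \<in> space P. \<forall>i\<in>{1..n}. N i t \<omega> \<le> k} \<in> sets P"
proof -
  have "{\<omega> \<in> space P. N i t \<omega> \<le> k} \<in> sets P" if i: "i \<in> {1..n}" for i
  proof -
    note [measurable] = measurable_box_count[OF assms(1) i assms(2)]
    show ?thesis
      by measurable
  qed
  then show ?thesis
    by (intro sets.sets_Collect_finite_All) auto
qed

lemma measurable_stopped_max:
  assumes N: "iid_unit_poisson_processes P N" and n: "n \<ge> 1"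
  shows "stopped_max m l N n \<in> measurable P (count_space UNIV)"
proof -
  let ?S = "\<lambda>\<omega>. stopping_set m l N n \<omega>"
  note path = iid_unit_poisson_processes_path[OF N]
  have count: "countable (\<rat> \<inter> {0::real..})"
    using countable_rat by (rule countable_subset[rotated]) auto
  have ne: "{\<omega> \<in> space P. ?S \<omega> \<noteq> {}} \<in> sets P"
  proof -
    have "?S \<omega> \<noteq> {} \<longleftrightarrow> (\<exists>q\<in>\<rat> \<inter> {0..}. q \<in> ?S \<omega>)" if "\<omega> \<in> space P" for \<omega>
      by (rule stopping_set_nonempty_iff_rat) (use path[OF that] in auto)
    then have "{\<omega> \<in> space P. ?S \<omega> \<noteq> {}} = (\<Union>q\<in>\<rat> \<inter> {0..}. {\<omega> \<in> space P. q \<in> ?S \<omega>})"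
      by blast
    also have "\<dots> \<in> sets P"
      using sets_stopped_by[OF N] by (intro sets.countable_UN'' count) auto
    finally show ?thesis .
  qed
  have le: "{\<omega> \<in> space P. stopped_max m l N n \<omega> \<le> k} \<in> sets P" for k
  proof -
    \<comment> \<open>On an empty stopping set the stopping time is 0 by convention.\<close>
    have "{\<omega> \<in> space P. stopped_max m l N n \<omega> \<le> k} =
        (\<Union>q\<in>\<rat> \<inter> {0..}. {\<omega> \<in> space P. q \<in> ?S \<omega>} \<inter> {\<omega> \<in> space P. \<forall>i\<in>{1..n}. N i q \<omega> \<le> k}) \<union>
        ((space P - {\<omega> \<in> space P. ?S \<omega> \<noteq> {}}) \<inter> {\<omega> \<in> space P. \<forall>i\<in>{1..n}. N i 0 \<omega> \<le> k})"
      (is "?L = ?R")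
    proof (rule set_eqI)
      fix \<omega>
      show "\<omega> \<in> ?L \<longleftrightarrow> \<omega> \<in> ?R"
      proof (cases "\<omega> \<in> space P \<and> ?S \<omega> \<noteq> {}")
        case True
        then show ?thesis
          by (subst mem_Collect_eq, subst stopped_max_le_iff_rat[OF _ _ n]) (use path[of \<omega>] in auto)
      next
        case False
        then show ?thesis
          using n by (auto simp: stopped_max_def stopping_time_def)
      qed
    qed
    also have "\<dots> \<in> sets P"
      using sets_stopped_by[OF N] sets_all_boxes_le[OF N] ne
      by (intro sets.Un sets.Int sets.Diff sets.top sets.countable_UN'' count) auto
    finally show ?thesis .
  qed
  show ?thesis
  proof (subst measurable_count_space_eq2_countable, intro conjI ballI)
    fix k :: nat
    have "stopped_max m l N n -` {k} \<inter> space P =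
        {\<omega> \<in> space P. stopped_max m l N n \<omega> \<le> k} - (if k = 0 then {} else {\<omega> \<in> space P. stopped_max m l N n \<omega> \<le> k - 1})"
      by auto
    also have "\<dots> \<in> sets P"
      using le[of 0] le[of k] le[of "k - 1"] by (cases "k = 0") auto
    finally show "stopped_max m l N n -` {k} \<inter> space P \<in> sets P" .
  qed auto
qed

section \<open>The Gumbel distributions\<close>

text \<open>
  The distribution function of the Gumbel(\<open>l + 1\<close>) law: the probability that a Poisson variable of
  mean \<open>exp (- s)\<close> is at most \<open>l\<close>.
\<close>

definition gumbel_cdf :: "nat \<Rightarrow> real \<Rightarrow> real" where
  "gumbel_cdf l s = (\<Sum>r\<le>l. exp (- s) ^ r / fact r) * exp (- exp (- s))"

lemma gumbel_cdf_0: "gumbel_cdf 0 s = exp (- exp (- s))"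
  by (simp add: gumbel_cdf_def)

lemma gumbel_density_nonneg: "0 \<le> gumbel_density k s"
  by (simp add: gumbel_density_def)

lemma gumbel_density_Suc: "gumbel_density (Suc l) s = exp (- s) ^ Suc l * exp (- exp (- s)) / fact l"
proof -
  have "exp (- (real (Suc l) * s) - exp (- s)) = exp (real (Suc l) * (- s)) * exp (- exp (- s))"
    by (simp flip: exp_add)
  then show ?thesis
    by (simp only: gumbel_density_def exp_of_nat_mult diff_Suc_1)
qed

text \<open>
  Differentiating the Poisson sum telescopes, and only the top term survives.
\<close>

lemma gumbel_cdf_has_derivative: "(gumbel_cdf l has_real_derivative gumbel_density (Suc l) s) (at s)"
proof (induction l)
  case 0
  have "((\<lambda>s. exp (- exp (- s))) has_real_derivative exp (- s) * exp (- exp (- s))) (at s)"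
    by (auto intro!: derivative_eq_intros)
  then show ?case
    by (simp add: gumbel_cdf_0[abs_def] gumbel_density_Suc)
next
  case (Suc l)
  let ?h = "\<lambda>k s. exp (- s) ^ k * exp (- exp (- s)) :: real"
  have "(?h (Suc l) has_real_derivative ?h (Suc (Suc l)) s - real (Suc l) * ?h (Suc l) s) (at s)"
    by (rule derivative_eq_intros refl)+ (simp add: algebra_simps)
  from DERIV_cdivide[OF this, of "fact (Suc l)"]
  have "((\<lambda>s. exp (- s) ^ Suc l / fact (Suc l) * exp (- exp (- s))) has_real_derivative
      (?h (Suc (Suc l)) s - real (Suc l) * ?h (Suc l) s) / fact (Suc l)) (at s)"
    by (simp del: power_Suc fact_Suc of_nat_Suc)
  moreover have "real (Suc l) * ?h (Suc l) s / fact (Suc l) = ?h (Suc l) s / fact l"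
    by simp
  then have "(?h (Suc (Suc l)) s - real (Suc l) * ?h (Suc l) s) / fact (Suc l) =
      gumbel_density (Suc (Suc l)) s - gumbel_density (Suc l) s"
    by (simp only: gumbel_density_Suc diff_divide_distrib)
  ultimately have "((\<lambda>s. exp (- s) ^ Suc l / fact (Suc l) * exp (- exp (- s))) has_real_derivative
      gumbel_density (Suc (Suc l)) s - gumbel_density (Suc l) s) (at s)"
    by simp
  from DERIV_add[OF Suc.IH this] show ?case
    by (simp add: gumbel_cdf_def[abs_def] distrib_right)
qed

lemma gumbel_cdf_at_top: "(gumbel_cdf l \<longlongrightarrow> 1) at_top"
proof -
  have "((\<lambda>s. (\<Sum>r\<le>l. exp (- s) ^ r / fact r) * exp (- exp (- s))) \<longlongrightarrow>
      (\<Sum>r\<le>l. 0 ^ r / fact r) * exp (- 0 :: real)) at_top"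
    by (intro tendsto_intros) (real_asymp | simp)+
  also have "(\<Sum>r\<le>l. 0 ^ r / fact r) = (\<Sum>r\<le>l. if r = 0 then 1 else (0 :: real))"
    by (intro sum.cong) auto
  finally show ?thesis
    by (simp add: gumbel_cdf_def[abs_def])
qed

lemma gumbel_cdf_at_bot: "(gumbel_cdf l \<longlongrightarrow> 0) at_bot"
proof -
  have top: "filterlim (\<lambda>s::real. exp (- s)) at_top at_bot"
    by real_asymp
  have "((\<lambda>s. \<Sum>r\<le>l. (exp (- s) ^ r / exp (exp (- s))) / fact r) \<longlongrightarrow> (\<Sum>r\<le>l. 0 / fact r)) (at_bot :: real filter)"
    by (intro tendsto_sum tendsto_divide filterlim_compose[OF tendsto_power_div_exp_0 top] tendsto_const) auto
  moreover have "(\<lambda>s. \<Sum>r\<le>l. (exp (- s) ^ r / exp (exp (- s))) / fact r) = gumbel_cdf l"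
    by (rule ext) (simp add: gumbel_cdf_def sum_distrib_left exp_minus[of "exp t" for t] divide_inverse mult_ac)
  ultimately show ?thesis
    by simp
qed

lemma mono_gumbel_cdf: "mono (gumbel_cdf l)"
proof (rule monoI)
  show "gumbel_cdf l s \<le> gumbel_cdf l t" if "s \<le> t" for s t
    using that gumbel_cdf_has_derivative gumbel_density_nonneg
    by (intro DERIV_nonneg_imp_nondecreasing[OF that]) blast
qed

lemma gumbel_cdf_le_1: "gumbel_cdf l s \<le> 1"
  using gumbel_cdf_at_top
proof (rule tendsto_lowerbound)
  show "eventually (\<lambda>t. gumbel_cdf l s \<le> gumbel_cdf l t) at_top"
    using eventually_ge_at_top[of s] by eventually_elim (rule monoD[OF mono_gumbel_cdf])
qed simp

text \<open>
  The density \<open>exp (- z - exp (- z))\<close> is at most 1 because \<open>exp (- z) \<ge> 1 - z\<close>.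
\<close>

lemma gumbel_cdf_0_lipschitz:
  assumes "s \<le> t"
  shows "gumbel_cdf 0 t - gumbel_cdf 0 s \<le> t - s"
proof (cases "s = t")
  case False
  obtain z where z: "gumbel_cdf 0 t - gumbel_cdf 0 s = (t - s) * gumbel_density (Suc 0) z"
    using MVT2[of s t "gumbel_cdf 0" "gumbel_density (Suc 0)"] assms False gumbel_cdf_has_derivative by auto
  have "gumbel_density (Suc 0) z \<le> 1"
    using exp_ge_add_one_self[of "- z"] by (simp add: gumbel_density_def)
  with assms show ?thesis
    unfolding z by (intro mult_left_le) auto
qed simp

text \<open>
  The complementary upper tail is a half-line integral of a derivative.
\<close>

lemma (in prob_space) prob_gumbel_less:
  assumes "distributed M lborel \<tau> (\<lambda>s. ennreal (gumbel_density (Suc l) s))"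
  shows "prob {\<omega> \<in> space M. \<tau> \<omega> < s} = gumbel_cdf l s"
proof -
  have [measurable]: "\<tau> \<in> borel_measurable M"
    using distributed_measurable[OF assms] by simp
  have [measurable]: "gumbel_density k \<in> borel_measurable borel" for k
    unfolding gumbel_density_def[abs_def] by measurable
  have "emeasure M (\<tau> -` {s..} \<inter> space M) = (\<integral>\<^sup>+x. ennreal (gumbel_density (Suc l) x) * indicator {s..} x \<partial>lborel)"
    by (rule distributed_emeasure[OF assms]) simp
  also have "\<dots> = ennreal (1 - gumbel_cdf l s)"
    by (rule nn_integral_FTC_atLeast)
       (auto intro: gumbel_cdf_has_derivative gumbel_density_nonneg gumbel_cdf_at_top)
  finally have "prob (\<tau> -` {s..} \<inter> space M) = 1 - gumbel_cdf l s"
    using gumbel_cdf_le_1[of l s] by (simp add: measure_def)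
  moreover have "{\<omega> \<in> space M. \<tau> \<omega> < s} = space M - \<tau> -` {s..} \<inter> space M"
    by auto
  ultimately show ?thesis
    by (simp only:) (subst prob_compl, auto)
qed

section \<open>Comparison on a grid of times\<close>

text \<open>
  Think of \<open>C j\<close> as ``the random time is at most \<open>t\<^sub>j\<close>'', of \<open>D j\<close> as ``the level is not exceeded at
  \<open>t\<^sub>j\<close>'', and of \<open>E\<close> as ``the level is not exceeded at the random time''. On \<open>C (Suc j) - C j\<close> the event
  \<open>E\<close> lies between \<open>D (Suc j)\<close> and \<open>D j\<close>. The probabilities of differences are written as differences
  of probabilities of \<open>C i \<inter> D j\<close>, the quantities with a product limit.
\<close>

lemma (in prob_space) sandwich_stopped_event:
  fixes C D :: "nat \<Rightarrow> 'a set"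
  assumes C: "\<And>j. C j \<in> events" and D: "\<And>j. D j \<in> events" and E: "E \<in> events"
    and mono: "\<And>j. C j \<subseteq> C (Suc j)"
    and lower: "\<And>j. C j \<inter> D j \<subseteq> E"
    and upper: "\<And>j. E \<inter> C (Suc j) - C j \<subseteq> D j"
  shows "(\<Sum>j<K. prob (C (Suc j) \<inter> D (Suc j)) - prob (C j \<inter> D (Suc j))) \<le> prob E"
    and "prob E \<le> prob (C 0) + (1 - prob (C K)) + (\<Sum>j<K. prob (C (Suc j) \<inter> D j) - prob (C j \<inter> D j))"
proof -
  have "(\<Sum>j<K. prob (C (Suc j) \<inter> D (Suc j)) - prob (C j \<inter> D (Suc j))) \<le> prob (E \<inter> C K)" for K
  proof (induction K)
    case (Suc K)
    have "prob (C (Suc K) \<inter> D (Suc K)) - prob (C K \<inter> D (Suc K)) = prob ((C (Suc K) \<inter> D (Suc K)) - (C K \<inter> D (Suc K)))"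
      using mono C D by (intro finite_measure_Diff[symmetric]) auto
    also have "\<dots> \<le> prob (E \<inter> C (Suc K) - E \<inter> C K)"
      using lower[of "Suc K"] C D E by (intro finite_measure_mono) auto
    also have "\<dots> = prob (E \<inter> C (Suc K)) - prob (E \<inter> C K)"
      using mono C E by (intro finite_measure_Diff) auto
    finally show ?case
      using Suc.IH by simp
  qed simp
  also have "prob (E \<inter> C K) \<le> prob E"
    using C E by (intro finite_measure_mono) auto
  finally show "(\<Sum>j<K. prob (C (Suc j) \<inter> D (Suc j)) - prob (C j \<inter> D (Suc j))) \<le> prob E" .
next
  have "prob (E \<inter> C K) \<le> prob (C 0) + (\<Sum>j<K. prob (C (Suc j) \<inter> D j) - prob (C j \<inter> D j))" for K
  proof (induction K)
    case 0
    show ?case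
      using C by (auto intro!: finite_measure_mono)
  next
    case (Suc K)
    have "prob (E \<inter> C (Suc K)) - prob (E \<inter> C K) = prob (E \<inter> C (Suc K) - E \<inter> C K)"
      using mono C E by (intro finite_measure_Diff[symmetric]) auto
    also have "\<dots> \<le> prob ((C (Suc K) \<inter> D K) - (C K \<inter> D K))"
      using upper[of K] C D by (intro finite_measure_mono) auto
    also have "\<dots> = prob (C (Suc K) \<inter> D K) - prob (C K \<inter> D K)"
      using mono C D by (intro finite_measure_Diff) auto
    finally show ?case
      using Suc.IH by simp
  qed
  moreover have "prob E \<le> prob (E \<inter> C K) + (1 - prob (C K))"
  proof -
    have "prob E \<le> prob ((E \<inter> C K) \<union> (space M - C K))"
      using C E sets.sets_into_space[OF E] by (intro finite_measure_mono) auto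
    also have "\<dots> \<le> prob (E \<inter> C K) + prob (space M - C K)"
      using C E by (intro measure_Un_le) auto
    finally show ?thesis
      using C by (simp add: prob_compl)
  qed
  ultimately show "prob E \<le> prob (C 0) + (1 - prob (C K)) + (\<Sum>j<K. prob (C (Suc j) \<inter> D j) - prob (C j \<inter> D j))"
    by (smt (verit))
qed

text \<open>
  The conclusion of \<open>sandwich_stopped_event\<close> when \<open>C i \<inter> D j\<close> has, up to an error that vanishes as
  \<open>n\<close> grows, the product probability \<open>G (\<sigma> i) * F n (\<sigma> j)\<close>. The sums are lower and upper
  Riemann--Stieltjes sums of \<open>F n\<close> with respect to \<open>G\<close>; the function \<open>F n\<close> may depend on \<open>n\<close>, the
  grid may not.
\<close>

definition grid_sandwiched :: "(real \<Rightarrow> real) \<Rightarrow> (nat \<Rightarrow> real \<Rightarrow> real) \<Rightarrow> (nat \<Rightarrow> real) \<Rightarrow> bool" where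
  "grid_sandwiched G F p \<longleftrightarrow> (\<forall>\<sigma> K \<epsilon>. incseq \<sigma> \<longrightarrow> 0 < \<epsilon> \<longrightarrow> (\<forall>\<^sub>F n in sequentially.
     (\<Sum>j<K. (G (\<sigma> (Suc j)) - G (\<sigma> j)) * F n (\<sigma> (Suc j))) - \<epsilon> \<le> p n \<and>
     p n \<le> G (\<sigma> 0) + (1 - G (\<sigma> K)) + (\<Sum>j<K. (G (\<sigma> (Suc j)) - G (\<sigma> j)) * F n (\<sigma> j)) + \<epsilon>))"

text \<open>
  The upper and lower bounds differ by the mass of \<open>G\<close> outside the grid plus the oscillation of
  \<open>F n\<close> over one mesh, and the Lipschitz constant \<open>c\<close> is uniform in \<open>n\<close>.
\<close>

lemma grid_sandwiched_unique:
  assumes p: "grid_sandwiched G F p" and q: "grid_sandwiched G F q"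
    and G: "mono G" "(G \<longlongrightarrow> 0) at_bot" "(G \<longlongrightarrow> 1) at_top"
    and F: "\<And>n s t. s \<le> t \<Longrightarrow> F n s - F n t \<le> c * (t - s)" and "0 < c"
  shows "(\<lambda>n. p n - q n) \<longlonglongrightarrow> 0"
proof (rule tendstoI)
  fix e :: real assume "e > 0"
  define \<epsilon> where "\<epsilon> = e / 6"
  have \<epsilon>: "\<epsilon> > 0"
    using \<open>e > 0\<close> by (simp add: \<epsilon>_def)
  obtain s0 where s0: "\<And>s. s \<le> s0 \<Longrightarrow> G s < \<epsilon>"
    using order_tendstoD(2)[OF G(2) \<epsilon>] by (auto simp: eventually_at_bot_linorder)
  obtain s1 where s1: "\<And>s. s \<ge> s1 \<Longrightarrow> G s > 1 - \<epsilon>"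
    using order_tendstoD(1)[OF G(3), of "1 - \<epsilon>"] \<epsilon> by (auto simp: eventually_at_top_linorder)
  have G01: "0 \<le> G s" "G s \<le> 1" for s
  proof -
    have "eventually (\<lambda>t. G t \<le> G s) at_bot"
      using eventually_le_at_bot[of s] by eventually_elim (rule monoD[OF G(1)])
    then show "0 \<le> G s"
      by (intro tendsto_upperbound[OF G(2)]) auto
    have "eventually (\<lambda>t. G s \<le> G t) at_top"
      using eventually_ge_at_top[of s] by eventually_elim (rule monoD[OF G(1)])
    then show "G s \<le> 1"
      by (intro tendsto_lowerbound[OF G(3)]) auto
  qed
  define h where "h = \<epsilon> / c"
  have h: "h > 0" "c * h = \<epsilon>"
    using \<epsilon> \<open>0 < c\<close> by (auto simp: h_def)
  obtain K where K: "real K * h > s1 - s0"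
    using reals_Archimedean3[OF h(1)] by blast
  define \<sigma> where "\<sigma> j = s0 + real j * h" for j
  have "incseq \<sigma>"
    using h by (intro incseq_SucI) (simp add: \<sigma>_def algebra_simps)
  with p q \<epsilon> have ev: "eventually (\<lambda>n.
     (\<Sum>j<K. (G (\<sigma> (Suc j)) - G (\<sigma> j)) * F n (\<sigma> (Suc j))) - \<epsilon> \<le> p n \<and>
     p n \<le> G (\<sigma> 0) + (1 - G (\<sigma> K)) + (\<Sum>j<K. (G (\<sigma> (Suc j)) - G (\<sigma> j)) * F n (\<sigma> j)) + \<epsilon>) sequentially"
    "eventually (\<lambda>n.
     (\<Sum>j<K. (G (\<sigma> (Suc j)) - G (\<sigma> j)) * F n (\<sigma> (Suc j))) - \<epsilon> \<le> q n \<and>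
     q n \<le> G (\<sigma> 0) + (1 - G (\<sigma> K)) + (\<Sum>j<K. (G (\<sigma> (Suc j)) - G (\<sigma> j)) * F n (\<sigma> j)) + \<epsilon>) sequentially"
    unfolding grid_sandwiched_def by blast+
  have ends: "G (\<sigma> 0) < \<epsilon>" "1 - G (\<sigma> K) < \<epsilon>"
    using s0[of "\<sigma> 0"] s1[of "\<sigma> K"] K by (auto simp: \<sigma>_def)
  have gap: "(\<Sum>j<K. (G (\<sigma> (Suc j)) - G (\<sigma> j)) * F n (\<sigma> j)) \<le>
      (\<Sum>j<K. (G (\<sigma> (Suc j)) - G (\<sigma> j)) * F n (\<sigma> (Suc j))) + \<epsilon>" for n
  proof -
    have "(\<Sum>j<K. (G (\<sigma> (Suc j)) - G (\<sigma> j)) * F n (\<sigma> j)) - (\<Sum>j<K. (G (\<sigma> (Suc j)) - G (\<sigma> j)) * F n (\<sigma> (Suc j)))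
      = (\<Sum>j<K. (G (\<sigma> (Suc j)) - G (\<sigma> j)) * (F n (\<sigma> j) - F n (\<sigma> (Suc j))))"
      by (simp add: sum_subtractf right_diff_distrib)
    also have "\<dots> \<le> (\<Sum>j<K. (G (\<sigma> (Suc j)) - G (\<sigma> j)) * \<epsilon>)"
    proof (intro sum_mono mult_left_mono)
      fix j
      show "F n (\<sigma> j) - F n (\<sigma> (Suc j)) \<le> \<epsilon>"
        using F[of "\<sigma> j" "\<sigma> (Suc j)" n] h by (simp add: \<sigma>_def algebra_simps)
      show "0 \<le> G (\<sigma> (Suc j)) - G (\<sigma> j)"
        using \<open>incseq \<sigma>\<close> by (simp add: monoD[OF G(1)] incseq_SucD)
    qed
    also have "\<dots> = (G (\<sigma> K) - G (\<sigma> 0)) * \<epsilon>"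
      using sum_lessThan_telescope[of "\<lambda>j. G (\<sigma> j)" K] by (simp flip: sum_distrib_right)
    also have "\<dots> \<le> 1 * \<epsilon>"
      using G01(1)[of "\<sigma> 0"] G01(2)[of "\<sigma> K"] \<epsilon> by (intro mult_right_mono) auto
    finally show ?thesis by simp
  qed
  show "eventually (\<lambda>n. dist (p n - q n) 0 < e) sequentially"
    using ev
  proof eventually_elim
    case (elim n)
    then show ?case
      using ends gap[of n] \<epsilon> by (auto simp: dist_real_def abs_if \<epsilon>_def)
  qed
qed

section \<open>Both maxima are sandwiched\<close>

text \<open>
  The two critical times differ by the constant \<open>t - s\<close>. A low box has probability \<open>O(1/n)\<close>, and in a
  bounded time it gains about \<open>k n\<close> balls only with vanishing probability.
\<close>

lemma low_high_prob_negligible: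
  fixes k :: "nat \<Rightarrow> nat"
  assumes k: "filterlim k at_top sequentially"
  shows "(\<lambda>n. real n * low_high_prob m (k n) (threshold_time m s n) (threshold_time m t n)) \<longlonglongrightarrow> 0"
proof -
  define g where "g n = (if s < t then measure (measure_pmf (poisson_pmf (t - s))) {k n - m<..} else 0)" for n
  have g: "g \<longlonglongrightarrow> 0"
  proof (cases "s < t")
    case True
    let ?p = "measure_pmf (poisson_pmf (t - s))"
    have "(\<lambda>i. measure ?p {..i}) \<longlonglongrightarrow> measure ?p (\<Union>i. {..i})"
      by (rule measure_pmf.finite_Lim_measure_incseq) (auto simp: incseq_def)
    moreover have "(\<Union>i. {..i}) = (UNIV :: nat set)"
      by auto
    ultimately have "(\<lambda>i. 1 - measure ?p {..i}) \<longlonglongrightarrow> 1 - 1"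
      by (intro tendsto_diff tendsto_const) simp
    moreover have "1 - measure ?p {..i} = measure ?p {i<..}" for i
      using measure_pmf.prob_compl[of "{..i}" "poisson_pmf (t - s)"] by (simp add: Compl_eq_Diff_UNIV[symmetric])
    ultimately have "(\<lambda>i. measure ?p {i<..}) \<longlonglongrightarrow> 0"
      by simp
    moreover have "filterlim (\<lambda>n. k n - m) at_top sequentially"
      using k filterlim_minus_const_nat_at_top by (rule filterlim_compose[rotated])
    ultimately show ?thesis
      using True unfolding g_def by (simp add: filterlim_compose[of "\<lambda>i. measure ?p {i<..}"])
  qed (simp add: g_def[abs_def])
  show ?thesis
  proof (rule Lim_null_comparison)
    have "eventually (\<lambda>n. 0 < threshold_time m s n) sequentially"
      using threshold_time_at_top[of m s] by (simp add: filterlim_at_top_dense)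
    then show "eventually (\<lambda>n. norm (real n * low_high_prob m (k n) (threshold_time m s n) (threshold_time m t n)) \<le>
        real n * measure (measure_pmf (poisson_pmf (threshold_time m s n))) {..m} * g n) sequentially"
    proof eventually_elim
      case (elim n)
      have "threshold_time m t n - threshold_time m s n = t - s"
        and "threshold_time m s n < threshold_time m t n \<longleftrightarrow> s < t"
        by (simp_all add: threshold_time_def)
      then have "low_high_prob m (k n) (threshold_time m s n) (threshold_time m t n) \<le>
          measure (measure_pmf (poisson_pmf (threshold_time m s n))) {..m} * g n"
        using low_high_prob_bounds(2)[OF elim, of m "k n" "threshold_time m t n"]
        by (cases "s < t") (simp_all add: g_def)
      then show ?case
        using low_high_prob_bounds(1)[OF elim, of m "k n" "threshold_time m t n"]
        by (simp add: mult.assoc mult_left_mono)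
    qed
    show "(\<lambda>n. real n * measure (measure_pmf (poisson_pmf (threshold_time m s n))) {..m} * g n) \<longlonglongrightarrow> 0"
      using tendsto_mult[OF threshold_time_lower_tail g] by simp
  qed
qed

lemma prob_stopped_by_limit:
  assumes N: "iid_unit_poisson_processes P N"
  shows "(\<lambda>n. measure P {\<omega> \<in> space P. threshold_time m s n \<in> stopping_set m l N n \<omega>}) \<longlonglongrightarrow> gumbel_cdf l s"
proof -
  let ?T = "threshold_time m s"
  interpret prob_space P
    using N by (simp add: iid_unit_poisson_processes_def)
  have box: "unit_poisson_process P (N i)" if "i \<ge> 1" for i
    using N that by (simp add: iid_unit_poisson_processes_def)
  define u where "u n = measure (measure_pmf (poisson_pmf (?T n))) {..m}" for n
  have u: "0 \<le> u n" "u n \<le> 1" for n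
    by (auto simp: u_def)
  \<comment> \<open>There is no high category here, so \<open>\<mu>\<close> is 0.\<close>
  have "(\<lambda>n. (\<Sum>r\<le>l. real (n choose r) * u n ^ r * (1 - u n) ^ (n - r)) -
      (\<Sum>r\<le>l. exp (- s) ^ r / fact r) * exp (- exp (- s)) * exp (- 0)) \<longlonglongrightarrow> 0"
  proof (rule trinomial_to_poisson)
    show "(\<lambda>n. real n * u n) \<longlonglongrightarrow> exp (- s)"
      unfolding u_def by (rule threshold_time_lower_tail)
    then show "(\<lambda>n. real n * (1 - (1 - u n)) - (exp (- s) + 0)) \<longlonglongrightarrow> 0"
      by (simp add: LIM_zero)
  qed (use u in auto)
  then have "(\<lambda>n. \<Sum>r\<le>l. real (n choose r) * u n ^ r * (1 - u n) ^ (n - r)) \<longlonglongrightarrow> gumbel_cdf l s"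
    by (simp add: gumbel_cdf_def LIM_zero_iff)
  moreover have "eventually (\<lambda>n. (\<Sum>r\<le>l. real (n choose r) * u n ^ r * (1 - u n) ^ (n - r)) =
      measure P {\<omega> \<in> space P. ?T n \<in> stopping_set m l N n \<omega>}) sequentially"
  proof -
    have "eventually (\<lambda>n. 0 < ?T n) sequentially"
      using threshold_time_at_top[of m s] by (simp add: filterlim_at_top_dense)
    then show ?thesis
      using eventually_ge_at_top[of 1]
    proof eventually_elim
      case (elim n)
      have low: "prob {\<omega> \<in> space P. N i (?T n) \<omega> \<in> {..m}} = u n"
        and high: "prob {\<omega> \<in> space P. N i (?T n) \<omega> \<in> {m<..}} = 1 - u n" if "i \<ge> 1" for i
        using unit_poisson_process.prob_process[OF box[OF that] elim(1), of "{..m}"]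
          unit_poisson_process.prob_process[OF box[OF that] elim(1), of "{m<..}"]
          measure_pmf.prob_compl[of "{..m}" "poisson_pmf (?T n)"]
        by (simp_all add: u_def Compl_eq_Diff_UNIV[symmetric])
      show ?case
        using prob_stopped_by_and[OF N elim(2), of "?T n" "?T n" m "\<lambda>_. True" "u n" "1 - u n" l] low high elim(1)
        by simp
    qed
  qed
  ultimately show ?thesis
    by (rule Lim_transform_eventually)
qed

lemma a_seq_at_top: "filterlim (a_seq m) at_top sequentially"
proof -
  define C where "C = ln ((exp 1 - 1) * fact m powr (exp 1 - 1) * sqrt (2 * pi * exp 1))"
  have eq: "a_seq m = (\<lambda>n. exp 1 * ln (real n) + ((exp 1 - 1) * real m - 1 / 2) * ln (ln (real n)) - C)"
    by (rule ext) (simp add: a_seq_def Let_def C_def)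
  show ?thesis
    unfolding eq by real_asymp
qed

context
  fixes k :: "nat \<Rightarrow> nat" and x :: "nat \<Rightarrow> real" and m :: nat
  assumes x: "Bseq x" and k: "eventually (\<lambda>n. real (k n) = a_seq m n + x n) sequentially"
begin

lemma level_at_top: "filterlim k at_top sequentially"
proof -
  obtain B where B: "\<And>n. norm (x n) \<le> B"
    using x by (auto simp: Bseq_def)
  have "filterlim (\<lambda>n. real (k n)) at_top sequentially"
  proof (rule filterlim_at_top_mono)
    show "filterlim (\<lambda>n. - B + a_seq m n) at_top sequentially"
      by (intro filterlim_tendsto_add_at_top[OF tendsto_const] a_seq_at_top)
    show "eventually (\<lambda>n. - B + a_seq m n \<le> real (k n)) sequentially"
      using k
    proof eventually_elim
      case (elim n)
      then show ?case
        using B[of n] by (simp add: abs_le_iff)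
    qed
  qed
  then show ?thesis
    by (simp add: filterlim_sequentially_iff_filterlim_real)
qed

text \<open>
  With \<open>a\<close>, \<open>b\<close> and \<open>J\<close> the probabilities that a box is low, high, and both, the category
  probabilities are \<open>u = a - J\<close> and \<open>v = 1 - a - b + J\<close>, and \<open>n J\<close> vanishes.
\<close>

lemma prob_stopped_by_and_all_low_limit:
  assumes N: "iid_unit_poisson_processes P N"
  shows "(\<lambda>n. measure P {\<omega> \<in> space P. threshold_time m s n \<in> stopping_set m l N n \<omega> \<and>
        (\<forall>i\<in>{1..n}. N i (threshold_time m t n) \<omega> \<le> k n)} -
      gumbel_cdf l s * gumbel_cdf 0 (x n - (exp 1 - 1) * t)) \<longlonglongrightarrow> 0"
proof -
  let ?S = "threshold_time m s" and ?T = "threshold_time m t"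
  interpret prob_space P
    using N by (simp add: iid_unit_poisson_processes_def)
  have box: "unit_poisson_process P (N i)" if "i \<ge> 1" for i
    using N that by (simp add: iid_unit_poisson_processes_def)
  define \<mu> where "\<mu> n = exp (- (x n - (exp 1 - 1) * t))" for n
  define a where "a n = measure (measure_pmf (poisson_pmf (?S n))) {..m}" for n
  define b where "b n = measure (measure_pmf (poisson_pmf (?T n))) {k n<..}" for n
  define J where "J n = low_high_prob m (k n) (?S n) (?T n)" for n
  define u where "u n = prob {\<omega> \<in> space P. N 1 (?S n) \<omega> \<le> m \<and> N 1 (?T n) \<omega> \<le> k n}" for n
  define v where "v n = prob {\<omega> \<in> space P. m < N 1 (?S n) \<omega> \<and> N 1 (?T n) \<omega> \<le> k n}" for n
  have lima: "(\<lambda>n. real n * a n) \<longlonglongrightarrow> exp (- s)"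
    unfolding a_def by (rule threshold_time_lower_tail)
  have limb: "(\<lambda>n. real n * b n - \<mu> n) \<longlonglongrightarrow> 0"
    unfolding b_def \<mu>_def by (rule threshold_time_upper_tail[OF x k])
  have limJ: "(\<lambda>n. real n * J n) \<longlonglongrightarrow> 0"
    unfolding J_def by (rule low_high_prob_negligible[OF level_at_top])
  have ev: "eventually (\<lambda>n. 0 < ?S n \<and> 0 < ?T n \<and> m \<le> k n \<and> 1 \<le> n) sequentially"
  proof -
    have "eventually (\<lambda>n. 0 < ?S n) sequentially" "eventually (\<lambda>n. 0 < ?T n) sequentially"
      using threshold_time_at_top[of m] by (simp_all add: filterlim_at_top_dense)
    moreover have "eventually (\<lambda>n. m \<le> k n) sequentially"
      using level_at_top by (simp add: filterlim_at_top)
    ultimately show ?thesis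
      using eventually_ge_at_top[of 1] by eventually_elim simp
  qed
  have uv: "prob {\<omega> \<in> space P. N i (?S n) \<omega> \<le> m \<and> N i (?T n) \<omega> \<le> k n} = a n - J n"
    "prob {\<omega> \<in> space P. m < N i (?S n) \<omega> \<and> N i (?T n) \<omega> \<le> k n} = 1 - a n - b n + J n"
    if "0 < ?S n \<and> 0 < ?T n \<and> m \<le> k n \<and> 1 \<le> n" and "i \<ge> 1" for i n
    using unit_poisson_process.prob_box_categories[OF box, of i "?S n" "?T n" m "k n"] that
    by (auto simp: a_def b_def J_def)
  have "(\<lambda>n. (\<Sum>r\<le>l. real (n choose r) * u n ^ r * v n ^ (n - r)) -
      (\<Sum>r\<le>l. exp (- s) ^ r / fact r) * exp (- exp (- s)) * exp (- \<mu> n)) \<longlonglongrightarrow> 0"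
  proof (rule trinomial_to_poisson)
    have "(\<lambda>n. real n * a n - real n * J n) \<longlonglongrightarrow> exp (- s) - 0"
      by (intro tendsto_diff lima limJ)
    moreover have "eventually (\<lambda>n. real n * a n - real n * J n = real n * u n) sequentially"
      using ev by eventually_elim (simp add: u_def uv right_diff_distrib)
    ultimately show "(\<lambda>n. real n * u n) \<longlonglongrightarrow> exp (- s)"
      using Lim_transform_eventually by force
    have "(\<lambda>n. (real n * a n - exp (- s)) + (real n * b n - \<mu> n) - real n * J n) \<longlonglongrightarrow> 0 + 0 - 0"
      by (intro tendsto_add tendsto_diff limb limJ LIM_zero lima)
    moreover have "eventually (\<lambda>n. (real n * a n - exp (- s)) + (real n * b n - \<mu> n) - real n * J n =
        real n * (1 - v n) - (exp (- s) + \<mu> n)) sequentially"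
      using ev by eventually_elim (simp add: v_def uv algebra_simps)
    ultimately show "(\<lambda>n. real n * (1 - v n) - (exp (- s) + \<mu> n)) \<longlonglongrightarrow> 0"
      using Lim_transform_eventually by force
    obtain B where B: "\<And>n. norm (x n) \<le> B"
      using x by (auto simp: Bseq_def)
    show "Bseq \<mu>"
    proof (rule BseqI')
      fix n
      show "norm (\<mu> n) \<le> exp (B + (exp 1 - 1) * t)"
        using B[of n] by (simp add: \<mu>_def abs_le_iff)
    qed
  qed (auto simp: u_def v_def \<mu>_def)
  moreover have "eventually (\<lambda>n. (\<Sum>r\<le>l. real (n choose r) * u n ^ r * v n ^ (n - r)) -
      (\<Sum>r\<le>l. exp (- s) ^ r / fact r) * exp (- exp (- s)) * exp (- \<mu> n) =
      prob {\<omega> \<in> space P. ?S n \<in> stopping_set m l N n \<omega> \<and> (\<forall>i\<in>{1..n}. N i (?T n) \<omega> \<le> k n)} -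
      gumbel_cdf l s * gumbel_cdf 0 (x n - (exp 1 - 1) * t)) sequentially"
    using ev
  proof eventually_elim
    case (elim n)
    have "prob {\<omega> \<in> space P. ?S n \<in> stopping_set m l N n \<omega> \<and> (\<forall>i\<in>{1..n}. N i (?T n) \<omega> \<le> k n)} =
        (\<Sum>r\<le>l. real (n choose r) * u n ^ r * v n ^ (n - r))"
      using elim uv[OF elim] by (intro prob_stopped_by_and[OF N]) (auto simp: u_def v_def)
    then show ?case
      by (simp add: gumbel_cdf_def \<mu>_def)
  qed
  ultimately show ?thesis
    by (rule Lim_transform_eventually)
qed

text \<open>
  Along every path the stopping set is an up-set and the box counts increase, which gives the inclusions
  required by \<open>sandwich_stopped_event\<close>. A fixed grid involves finitely many joint probabilities, so for
  large \<open>n\<close> all of them are simultaneously close to their product limits.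
\<close>

lemma stopped_max_grid_sandwiched:
  assumes N: "iid_unit_poisson_processes P N"
  shows "grid_sandwiched (gumbel_cdf l) (\<lambda>n s. gumbel_cdf 0 (x n - (exp 1 - 1) * s))
    (\<lambda>n. measure P {\<omega> \<in> space P. stopped_max m l N n \<omega> \<le> k n})"
  unfolding grid_sandwiched_def
proof (intro allI impI)
  fix \<sigma> :: "nat \<Rightarrow> real" and K :: nat and \<epsilon> :: real
  assume \<sigma>: "incseq \<sigma>" and \<epsilon>: "0 < \<epsilon>"
  interpret prob_space P
    using N by (simp add: iid_unit_poisson_processes_def)
  let ?T = "\<lambda>j n. threshold_time m (\<sigma> j) n"
  let ?G = "\<lambda>j. gumbel_cdf l (\<sigma> j)" and ?F = "\<lambda>n j. gumbel_cdf 0 (x n - (exp 1 - 1) * \<sigma> j)"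
  define C where "C n j = {\<omega> \<in> space P. ?T j n \<in> stopping_set m l N n \<omega>}" for n j
  define D where "D n j = {\<omega> \<in> space P. \<forall>i\<in>{1..n}. N i (?T j n) \<omega> \<le> k n}" for n j
  define E where "E n = {\<omega> \<in> space P. stopped_max m l N n \<omega> \<le> k n}" for n
  have lim: "(\<lambda>n. prob (C n i \<inter> D n j) - ?G i * ?F n j) \<longlonglongrightarrow> 0" for i j
  proof -
    have "C n i \<inter> D n j = {\<omega> \<in> space P. ?T i n \<in> stopping_set m l N n \<omega> \<and> (\<forall>i\<in>{1..n}. N i (?T j n) \<omega> \<le> k n)}" for n
      by (auto simp: C_def D_def)
    then show ?thesis
      using prob_stopped_by_and_all_low_limit[OF N] by simp
  qed
  have limC: "(\<lambda>n. prob (C n j)) \<longlonglongrightarrow> ?G j" for j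
    unfolding C_def by (rule prob_stopped_by_limit[OF N])
  have "(\<lambda>n. \<Sum>j<K. (prob (C n (Suc j) \<inter> D n (Suc j)) - ?G (Suc j) * ?F n (Suc j)) -
      (prob (C n j \<inter> D n (Suc j)) - ?G j * ?F n (Suc j))) \<longlonglongrightarrow> (\<Sum>j<K. 0 - 0)"
    by (intro tendsto_sum tendsto_diff lim)
  then have "eventually (\<lambda>n. (\<Sum>j<K. (prob (C n (Suc j) \<inter> D n (Suc j)) - ?G (Suc j) * ?F n (Suc j)) -
      (prob (C n j \<inter> D n (Suc j)) - ?G j * ?F n (Suc j))) > - \<epsilon>) sequentially"
    using \<epsilon> by (intro order_tendstoD) auto
  then have lower: "eventually (\<lambda>n. (\<Sum>j<K. (?G (Suc j) - ?G j) * ?F n (Suc j)) - \<epsilon> \<le>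
      (\<Sum>j<K. prob (C n (Suc j) \<inter> D n (Suc j)) - prob (C n j \<inter> D n (Suc j)))) sequentially"
    by eventually_elim (simp add: sum_subtractf left_diff_distrib)
  have "(\<lambda>n. (prob (C n 0) - ?G 0) - (prob (C n K) - ?G K) +
      (\<Sum>j<K. (prob (C n (Suc j) \<inter> D n j) - ?G (Suc j) * ?F n j) - (prob (C n j \<inter> D n j) - ?G j * ?F n j)))
      \<longlonglongrightarrow> 0 - 0 + (\<Sum>j<K. 0 - 0)"
    by (intro tendsto_add tendsto_sum tendsto_diff lim LIM_zero limC)
  then have "eventually (\<lambda>n. (prob (C n 0) - ?G 0) - (prob (C n K) - ?G K) +
      (\<Sum>j<K. (prob (C n (Suc j) \<inter> D n j) - ?G (Suc j) * ?F n j) - (prob (C n j \<inter> D n j) - ?G j * ?F n j)) < \<epsilon>) sequentially"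
    using \<epsilon> by (intro order_tendstoD) auto
  then have upper: "eventually (\<lambda>n. prob (C n 0) + (1 - prob (C n K)) +
      (\<Sum>j<K. prob (C n (Suc j) \<inter> D n j) - prob (C n j \<inter> D n j)) \<le>
      ?G 0 + (1 - ?G K) + (\<Sum>j<K. (?G (Suc j) - ?G j) * ?F n j) + \<epsilon>) sequentially"
    by eventually_elim (simp add: sum_subtractf left_diff_distrib)
  have ev: "eventually (\<lambda>n. 0 \<le> ?T 0 n) sequentially"
    using threshold_time_at_top[of m "\<sigma> 0"] by (simp add: filterlim_at_top)
  show "eventually (\<lambda>n. (\<Sum>j<K. (?G (Suc j) - ?G j) * ?F n (Suc j)) - \<epsilon> \<le> prob {\<omega> \<in> space P. stopped_max m l N n \<omega> \<le> k n} \<and>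
      prob {\<omega> \<in> space P. stopped_max m l N n \<omega> \<le> k n} \<le> ?G 0 + (1 - ?G K) + (\<Sum>j<K. (?G (Suc j) - ?G j) * ?F n j) + \<epsilon>) sequentially"
    using lower upper ev eventually_ge_at_top[of 1]
  proof eventually_elim
    case (elim n)
    have Tmono: "?T i n \<le> ?T j n" if "i \<le> j" for i j
      using incseqD[OF \<sigma> that] by (simp add: threshold_time_def)
    have T: "0 \<le> ?T j n" for j
      using Tmono[of 0 j] elim(3) by simp
    note path = iid_unit_poisson_processes_path[OF N]
    have sets: "C n j \<in> events" "D n j \<in> events" for j
      unfolding C_def D_def using sets_stopped_by[OF N T] sets_all_boxes_le[OF N T] by blast+
    have [measurable]: "stopped_max m l N n \<in> measurable P (count_space UNIV)"
      by (rule measurable_stopped_max[OF N elim(4)])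
    have E: "E n \<in> events"
      unfolding E_def by measurable
    have mono: "C n j \<subseteq> C n (Suc j)" for j
    proof
      fix \<omega> assume "\<omega> \<in> C n j"
      then have \<omega>: "\<omega> \<in> space P" "?T j n \<in> stopping_set m l N n \<omega>"
        by (auto simp: C_def)
      have "?T (Suc j) n \<in> stopping_set m l N n \<omega>"
        by (rule stopping_set_upward_closed[where s = "?T j n"])
           (use \<omega> path[OF \<omega>(1)] Tmono[of j "Suc j"] in auto)
      with \<omega>(1) show "\<omega> \<in> C n (Suc j)"
        by (simp add: C_def)
    qed
    have low: "C n j \<inter> D n j \<subseteq> E n" for j
    proof
      fix \<omega> assume "\<omega> \<in> C n j \<inter> D n j"
      then have \<omega>: "\<omega> \<in> space P" "?T j n \<in> stopping_set m l N n \<omega>" "\<forall>i\<in>{1..n}. N i (?T j n) \<omega> \<le> k n"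
        by (auto simp: C_def D_def)
      have "stopped_max m l N n \<omega> \<le> k n"
        by (rule stopped_max_le[where t = "?T j n"]) (use \<omega> path[OF \<omega>(1)] elim(4) in auto)
      with \<omega>(1) show "\<omega> \<in> E n"
        by (simp add: E_def)
    qed
    have up: "E n \<inter> C n (Suc j) - C n j \<subseteq> D n j" for j
    proof
      fix \<omega> assume "\<omega> \<in> E n \<inter> C n (Suc j) - C n j"
      then have \<omega>: "\<omega> \<in> space P" "stopped_max m l N n \<omega> \<le> k n"
        "stopping_set m l N n \<omega> \<noteq> {}" "?T j n \<notin> stopping_set m l N n \<omega>"
        by (auto simp: C_def E_def)
      have "N i (?T j n) \<omega> \<le> k n" if "i \<in> {1..n}" for i
        by (rule stopped_max_leD[where t = "?T j n"]) (use \<omega> path[OF \<omega>(1)] T[of j] that in auto)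
      with \<omega>(1) show "\<omega> \<in> D n j"
        by (simp add: D_def)
    qed
    show ?case
      using sandwich_stopped_event[of "C n" "D n" "E n" K, OF sets E mono low up] elim(1,2)
      unfolding E_def[symmetric] by linarith
  qed
qed

end

text \<open>
  The sum \<open>\<xi> + c \<tau>\<close> plays the part of the stopped maximum: the level \<open>\<xi> + c s\<close> is nondecreasing in \<open>s\<close>
  and is evaluated at the independent time \<open>\<tau>\<close>. Here the product formula is exact.
\<close>

lemma gumbel_sum_grid_sandwiched:
  fixes x :: "nat \<Rightarrow> real"
  assumes Q: "prob_space Q" and indep: "prob_space.indep_var Q borel \<xi> borel \<tau>"
    and \<xi>: "\<And>y. cdf (distr Q borel \<xi>) y = exp (- exp (- y))"
    and \<tau>: "distributed Q lborel \<tau> (\<lambda>s. ennreal (gumbel_density (Suc l) s))"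
    and c: "0 \<le> c"
  shows "grid_sandwiched (gumbel_cdf l) (\<lambda>n s. gumbel_cdf 0 (x n - c * s))
    (\<lambda>n. measure Q {\<omega> \<in> space Q. \<xi> \<omega> + c * \<tau> \<omega> \<le> x n})"
  unfolding grid_sandwiched_def
proof (intro allI impI always_eventually)
  fix \<sigma> :: "nat \<Rightarrow> real" and K n :: nat and \<epsilon> :: real
  assume \<sigma>: "incseq \<sigma>" and \<epsilon>: "0 < \<epsilon>"
  interpret prob_space Q by fact
  have [measurable]: "\<xi> \<in> borel_measurable Q" "\<tau> \<in> borel_measurable Q"
    using indep_var_rv1[OF indep] indep_var_rv2[OF indep] .
  \<comment> \<open>Strict inequality matches \<open>prob_gumbel_less\<close>; on the complement \<open>\<tau> \<ge> \<sigma> j\<close>, so that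
    \<open>\<xi> + c \<tau>\<close> is at least \<open>\<xi> + c \<sigma> j\<close>.\<close>
  define C where "C j = {\<omega> \<in> space Q. \<tau> \<omega> < \<sigma> j}" for j
  define D where "D j = {\<omega> \<in> space Q. \<xi> \<omega> + c * \<sigma> j \<le> x n}" for j
  define E where "E = {\<omega> \<in> space Q. \<xi> \<omega> + c * \<tau> \<omega> \<le> x n}"
  have probC: "prob (C j) = gumbel_cdf l (\<sigma> j)" for j
    unfolding C_def by (rule prob_gumbel_less[OF \<tau>])
  have probD: "prob (D j) = gumbel_cdf 0 (x n - c * \<sigma> j)" for j
  proof -
    have "D j = \<xi> -` {..x n - c * \<sigma> j} \<inter> space Q"
      by (auto simp: D_def)
    then show ?thesis
      using \<xi>[of "x n - c * \<sigma> j"] by (simp add: cdf_def measure_distr gumbel_cdf_0)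
  qed
  have probCD: "prob (C i \<inter> D j) = gumbel_cdf l (\<sigma> i) * gumbel_cdf 0 (x n - c * \<sigma> j)" for i j
  proof -
    have CD: "C i = \<tau> -` {..<\<sigma> i} \<inter> space Q" "D j = \<xi> -` {..x n - c * \<sigma> j} \<inter> space Q"
      by (auto simp: C_def D_def)
    have "C i \<inter> D j = (\<lambda>\<omega>. (\<xi> \<omega>, \<tau> \<omega>)) -` ({..x n - c * \<sigma> j} \<times> {..<\<sigma> i}) \<inter> space Q"
      by (auto simp: C_def D_def)
    also have "prob \<dots> = prob (D j) * prob (C i)"
      unfolding CD by (rule indep_varD[OF indep]) auto
    finally show ?thesis
      by (simp add: probC probD)
  qed
  have sets: "C j \<in> events" "D j \<in> events" "E \<in> events" for j
    unfolding C_def D_def E_def by measurable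
  have mono: "C j \<subseteq> C (Suc j)" for j
    using incseq_SucD[OF \<sigma>, of j] by (auto simp: C_def)
  have low: "C j \<inter> D j \<subseteq> E" for j
  proof
    fix \<omega> assume \<omega>: "\<omega> \<in> C j \<inter> D j"
    then have "c * \<tau> \<omega> \<le> c * \<sigma> j"
      using c by (intro mult_left_mono) (auto simp: C_def)
    with \<omega> show "\<omega> \<in> E"
      by (auto simp: C_def D_def E_def)
  qed
  have up: "E \<inter> C (Suc j) - C j \<subseteq> D j" for j
  proof
    fix \<omega> assume \<omega>: "\<omega> \<in> E \<inter> C (Suc j) - C j"
    then have "c * \<sigma> j \<le> c * \<tau> \<omega>"
      using c by (intro mult_left_mono) (auto simp: C_def)
    with \<omega> show "\<omega> \<in> D j"
      by (auto simp: C_def D_def E_def)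
  qed
  show "(\<Sum>j<K. (gumbel_cdf l (\<sigma> (Suc j)) - gumbel_cdf l (\<sigma> j)) * gumbel_cdf 0 (x n - c * \<sigma> (Suc j))) - \<epsilon>
      \<le> prob {\<omega> \<in> space Q. \<xi> \<omega> + c * \<tau> \<omega> \<le> x n} \<and>
      prob {\<omega> \<in> space Q. \<xi> \<omega> + c * \<tau> \<omega> \<le> x n} \<le> gumbel_cdf l (\<sigma> 0) + (1 - gumbel_cdf l (\<sigma> K)) +
        (\<Sum>j<K. (gumbel_cdf l (\<sigma> (Suc j)) - gumbel_cdf l (\<sigma> j)) * gumbel_cdf 0 (x n - c * \<sigma> j)) + \<epsilon>"
    using sandwich_stopped_event[of C D E K, OF sets mono low up] \<epsilon>
    unfolding E_def[symmetric] by (simp add: probC probCD left_diff_distrib)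
qed

section \<open>Total variation distance\<close>

text \<open>
  Tightness of one of the two sequences suffices: it confines both to a common finite interval up
  to \<open>\<epsilon>\<close>, because the distribution functions merge at the two end points. Inside the interval there
  are finitely many atoms, each of which is a difference of two values of the distribution function.
\<close>

lemma tv_dist_tendsto_0:
  fixes \<mu> \<nu> :: "nat \<Rightarrow> int measure"
  assumes \<mu>: "\<And>n. prob_space (\<mu> n)" "\<And>n. sets (\<mu> n) = UNIV"
    and \<nu>: "\<And>n. prob_space (\<nu> n)" "\<And>n. sets (\<nu> n) = UNIV"
    and cdf: "\<And>r. (\<lambda>n. measure (\<mu> n) {..r} - measure (\<nu> n) {..r}) \<longlonglongrightarrow> 0"
    and tight: "\<And>\<epsilon>. \<epsilon> > 0 \<Longrightarrow> \<exists>a b. a \<le> b \<and> (\<forall>n. measure (\<nu> n) {..a} < \<epsilon> \<and> measure (\<nu> n) {..b} > 1 - \<epsilon>)"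
  shows "(\<lambda>n. tv_dist (\<mu> n) (\<nu> n)) \<longlonglongrightarrow> 0"
proof -
  have sp: "space (\<mu> n) = UNIV" "space (\<nu> n) = UNIV" for n
    using sets_eq_imp_space_eq[of "\<mu> n" "count_space UNIV"] sets_eq_imp_space_eq[of "\<nu> n" "count_space UNIV"] \<mu>(2) \<nu>(2) by auto
  have rays: "measure M {r} = measure M {..r} - measure M {..r - 1}"
    if "prob_space M" "sets M = UNIV" for M and r :: int
  proof -
    interpret prob_space M by fact
    have "{r} = {..r} - {..r - 1}" by auto
    also have "measure M \<dots> = measure M {..r} - measure M {..r - 1}"
      using that by (intro finite_measure_Diff) auto
    finally show ?thesis .
  qed
  have split: "measure M A = (\<Sum>r\<in>A \<inter> {a<..b}. measure M {r}) + measure M (A - {a<..b}) \<and>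
      measure M (A - {a<..b}) \<le> measure M {..a} + (1 - measure M {..b})"
    if M: "prob_space M" "sets M = UNIV" "space M = UNIV" and "a \<le> b" for M and a b :: int and A
  proof -
    interpret prob_space M by fact
    have "measure M A = measure M (A \<inter> {a<..b}) + measure M (A - {a<..b})"
      using M by (subst finite_measure_Union[symmetric]) (auto intro!: arg_cong[where f = "measure M"])
    moreover have "measure M (A \<inter> {a<..b}) = (\<Sum>r\<in>A \<inter> {a<..b}. measure M {r})"
      using M by (intro finite_measure_eq_sum_singleton) auto
    moreover have "measure M (A - {a<..b}) \<le> measure M ({..a} \<union> (space M - {..b}))"
      using M by (intro finite_measure_mono) auto
    moreover have "\<dots> \<le> measure M {..a} + measure M (space M - {..b})"
      using M by (intro measure_Un_le) auto
    moreover have "measure M (space M - {..b}) = 1 - measure M {..b}"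
      using M by (intro prob_compl) auto
    ultimately show ?thesis by simp
  qed
  show ?thesis
  proof (rule LIMSEQ_I)
    fix e :: real assume "e > 0"
    define \<epsilon> where "\<epsilon> = e / 8"
    have \<epsilon>: "\<epsilon> > 0" using \<open>e > 0\<close> by (simp add: \<epsilon>_def)
    obtain a b where ab: "a \<le> b" "\<And>n. measure (\<nu> n) {..a} < \<epsilon>" "\<And>n. measure (\<nu> n) {..b} > 1 - \<epsilon>"
      using tight[OF \<epsilon>] by blast
    define \<delta> where "\<delta> n r = \<bar>measure (\<mu> n) {..r} - measure (\<nu> n) {..r}\<bar>" for n r
    define S where "S n = (\<Sum>r\<in>{a<..b}. \<delta> n r + \<delta> n (r - 1)) + \<delta> n a + \<delta> n b" for n
    have "S \<longlonglongrightarrow> (\<Sum>r\<in>{a<..b}. 0 + 0) + 0 + 0"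
      unfolding S_def[abs_def] \<delta>_def
      by (intro tendsto_add tendsto_sum tendsto_rabs_zero cdf)
    then have "eventually (\<lambda>n. S n < \<epsilon>) sequentially"
      using \<epsilon> by (intro order_tendstoD) auto
    then obtain n0 where n0: "\<And>n. n \<ge> n0 \<Longrightarrow> S n < \<epsilon>"
      by (auto simp: eventually_sequentially)
    have "norm (tv_dist (\<mu> n) (\<nu> n) - 0) < e" if "n \<ge> n0" for n
    proof -
      have bound: "\<bar>measure (\<mu> n) A - measure (\<nu> n) A\<bar> \<le> 5 * \<epsilon>" for A
      proof -
        note s1 = split[OF \<mu>(1)[of n] \<mu>(2) sp(1) ab(1), of A]
        note s2 = split[OF \<nu>(1)[of n] \<nu>(2) sp(2) ab(1), of A]
        have "\<bar>(\<Sum>r\<in>A \<inter> {a<..b}. measure (\<mu> n) {r}) - (\<Sum>r\<in>A \<inter> {a<..b}. measure (\<nu> n) {r})\<bar>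
            \<le> (\<Sum>r\<in>A \<inter> {a<..b}. \<bar>measure (\<mu> n) {r} - measure (\<nu> n) {r}\<bar>)"
          unfolding sum_subtractf[symmetric] by (rule sum_abs)
        also have "\<dots> \<le> (\<Sum>r\<in>A \<inter> {a<..b}. \<delta> n r + \<delta> n (r - 1))"
          by (intro sum_mono) (auto simp: rays[OF \<mu>] rays[OF \<nu>] \<delta>_def)
        also have "\<dots> \<le> (\<Sum>r\<in>{a<..b}. \<delta> n r + \<delta> n (r - 1))"
          by (intro sum_mono2) (auto simp: \<delta>_def)
        finally have "\<bar>(\<Sum>r\<in>A \<inter> {a<..b}. measure (\<mu> n) {r}) - (\<Sum>r\<in>A \<inter> {a<..b}. measure (\<nu> n) {r})\<bar>
            \<le> S n - \<delta> n a - \<delta> n b"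
          by (simp add: S_def)
        moreover have "measure (\<mu> n) {..a} \<le> measure (\<nu> n) {..a} + \<delta> n a" "measure (\<mu> n) {..b} \<ge> measure (\<nu> n) {..b} - \<delta> n b"
          by (auto simp: \<delta>_def)
        moreover have "measure (\<mu> n) (A - {a<..b}) \<ge> 0" "measure (\<nu> n) (A - {a<..b}) \<ge> 0"
          by auto
        ultimately show ?thesis
          using s1 s2 ab(2,3)[of n] n0[OF that] by (smt (verit))
      qed
      have "tv_dist (\<mu> n) (\<nu> n) \<le> 5 * \<epsilon>"
        unfolding tv_dist_def by (intro cSUP_least bound) (use \<mu> in auto)
      moreover have "0 \<le> tv_dist (\<mu> n) (\<nu> n)"
      proof -
        have "\<bar>measure (\<mu> n) {} - measure (\<nu> n) {}\<bar> \<le> tv_dist (\<mu> n) (\<nu> n)"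
          unfolding tv_dist_def using bound \<mu>(2) by (intro cSUP_upper bdd_aboveI2) auto
        then show ?thesis by simp
      qed
      ultimately show ?thesis
        using \<open>e > 0\<close> by (simp add: \<epsilon>_def)
    qed
    then show "\<exists>n0. \<forall>n\<ge>n0. norm (tv_dist (\<mu> n) (\<nu> n) - 0) < e"
      by blast
  qed
qed

theorem theorem4p3:
  fixes P :: "'a measure" and Q :: "'b measure"
    and N :: "nat \<Rightarrow> real \<Rightarrow> 'a \<Rightarrow> nat"
    and \<xi> \<tau> :: "'b \<Rightarrow> real"
    and m l :: nat
  assumes "iid_unit_poisson_processes P N"
    and "prob_space Q"
    and "prob_space.indep_var Q borel \<xi> borel \<tau>"
    and "\<And>x. cdf (distr Q borel \<xi>) x = exp (- exp (- x))"
    and "distributed Q lborel \<tau> (\<lambda>s. ennreal (gumbel_density (l + 1) s))"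
  shows "(\<lambda>n. tv_dist
            (distr P (count_space UNIV) (\<lambda>\<omega>. int (stopped_max m l N n \<omega>) - b_seq m n))
            (distr Q (count_space UNIV) (\<lambda>\<omega>. \<lceil>\<xi> \<omega> + (exp 1 - 1) * \<tau> \<omega> + c_seq m n\<rceil>)))
          \<longlonglongrightarrow> 0"
proof -
  note N = assms(1)
  interpret P: prob_space P
    using N by (simp add: iid_unit_poisson_processes_def)
  interpret Q: prob_space Q by fact
  let ?c = "exp 1 - 1 :: real"
  let ?W = "\<lambda>\<omega>. \<xi> \<omega> + ?c * \<tau> \<omega>"
  have c: "0 < ?c"
    by simp
  have [measurable]: "\<xi> \<in> borel_measurable Q" "\<tau> \<in> borel_measurable Q"
    using Q.indep_var_rv1[OF assms(3)] Q.indep_var_rv2[OF assms(3)] .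
  have M[measurable]: "stopped_max m l N n \<in> measurable P (count_space UNIV)" for n
  proof (cases "n = 0")
    case True
    \<comment> \<open>With no boxes the maximum is an unspecified constant, which is still measurable.\<close>
    then have "stopped_max m l N n = (\<lambda>_. Max {})"
      by (auto simp: stopped_max_def)
    then show ?thesis by simp
  qed (use measurable_stopped_max[OF N] in auto)
  have Z[measurable]: "(\<lambda>\<omega>. \<lceil>?W \<omega> + c_seq m n\<rceil>) \<in> measurable Q (count_space UNIV)" for n
    by measurable
  have c01: "0 \<le> c_seq m n" "c_seq m n < 1" for n
    unfolding c_seq_def by linarith+
  show ?thesis
  proof (rule tv_dist_tendsto_0)
    show "prob_space (distr P (count_space UNIV) (\<lambda>\<omega>. int (stopped_max m l N n \<omega>) - b_seq m n))" for n
      by (rule P.prob_space_distr) measurable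
    show "prob_space (distr Q (count_space UNIV) (\<lambda>\<omega>. \<lceil>?W \<omega> + c_seq m n\<rceil>))" for n
      by (rule Q.prob_space_distr) measurable
  next
    fix r :: int
    define x where "x n = of_int r - c_seq m n" for n
    define k where "k n = nat (b_seq m n + r)" for n
    have "norm (x n) \<le> \<bar>of_int r\<bar> + 1" for n
      using c01[of n] by (simp add: x_def abs_if)
    then have x: "Bseq x"
      by (rule BseqI')
    have "eventually (\<lambda>n. a_seq m n \<ge> 1 - of_int r) sequentially"
      using a_seq_at_top by (simp add: filterlim_at_top)
    then have kev: "eventually (\<lambda>n. 0 \<le> b_seq m n + r) sequentially"
      by eventually_elim (simp add: b_seq_def, linarith)
    then have k: "eventually (\<lambda>n. real (k n) = a_seq m n + x n) sequentially"
      by eventually_elim (simp add: k_def x_def b_seq_def c_seq_def)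
    have "(\<lambda>n. measure P {\<omega> \<in> space P. stopped_max m l N n \<omega> \<le> k n} -
        measure Q {\<omega> \<in> space Q. ?W \<omega> \<le> x n}) \<longlonglongrightarrow> 0"
    proof (rule grid_sandwiched_unique)
      show "grid_sandwiched (gumbel_cdf l) (\<lambda>n s. gumbel_cdf 0 (x n - ?c * s))
          (\<lambda>n. measure P {\<omega> \<in> space P. stopped_max m l N n \<omega> \<le> k n})"
        by (rule stopped_max_grid_sandwiched[OF x k N])
      show "grid_sandwiched (gumbel_cdf l) (\<lambda>n s. gumbel_cdf 0 (x n - ?c * s))
          (\<lambda>n. measure Q {\<omega> \<in> space Q. ?W \<omega> \<le> x n})"
        using assms by (intro gumbel_sum_grid_sandwiched) auto
      show "gumbel_cdf 0 (x n - ?c * s) - gumbel_cdf 0 (x n - ?c * t) \<le> ?c * (t - s)" if "s \<le> t" for n s t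
      proof -
        have "?c * s \<le> ?c * t"
          using that c by (intro mult_left_mono) auto
        with gumbel_cdf_0_lipschitz[of "x n - ?c * t" "x n - ?c * s"] show ?thesis
          unfolding right_diff_distrib by linarith
      qed
    qed (use mono_gumbel_cdf gumbel_cdf_at_bot gumbel_cdf_at_top in auto)
    moreover have "eventually (\<lambda>n. measure P {\<omega> \<in> space P. stopped_max m l N n \<omega> \<le> k n} -
        measure Q {\<omega> \<in> space Q. ?W \<omega> \<le> x n} =
        measure (distr P (count_space UNIV) (\<lambda>\<omega>. int (stopped_max m l N n \<omega>) - b_seq m n)) {..r} -
        measure (distr Q (count_space UNIV) (\<lambda>\<omega>. \<lceil>?W \<omega> + c_seq m n\<rceil>)) {..r}) sequentially"
      using kev
    proof eventually_elim
      case (elim n)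
      have "measure (distr P (count_space UNIV) (\<lambda>\<omega>. int (stopped_max m l N n \<omega>) - b_seq m n)) {..r} =
          measure P ((\<lambda>\<omega>. int (stopped_max m l N n \<omega>) - b_seq m n) -` {..r} \<inter> space P)"
        by (rule measure_distr) auto
      also have "(\<lambda>\<omega>. int (stopped_max m l N n \<omega>) - b_seq m n) -` {..r} \<inter> space P =
          {\<omega> \<in> space P. stopped_max m l N n \<omega> \<le> k n}"
        using elim by (auto simp: k_def)
      finally have a: "measure (distr P (count_space UNIV) (\<lambda>\<omega>. int (stopped_max m l N n \<omega>) - b_seq m n)) {..r} =
          measure P {\<omega> \<in> space P. stopped_max m l N n \<omega> \<le> k n}" .
      have "measure (distr Q (count_space UNIV) (\<lambda>\<omega>. \<lceil>?W \<omega> + c_seq m n\<rceil>)) {..r} =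
          measure Q ((\<lambda>\<omega>. \<lceil>?W \<omega> + c_seq m n\<rceil>) -` {..r} \<inter> space Q)"
        by (rule measure_distr) auto
      also have "(\<lambda>\<omega>. \<lceil>?W \<omega> + c_seq m n\<rceil>) -` {..r} \<inter> space Q = {\<omega> \<in> space Q. ?W \<omega> \<le> x n}"
        by (auto simp: ceiling_le_iff x_def)
      finally show ?case
        using a by simp
    qed
    ultimately show "(\<lambda>n. measure (distr P (count_space UNIV) (\<lambda>\<omega>. int (stopped_max m l N n \<omega>) - b_seq m n)) {..r} -
        measure (distr Q (count_space UNIV) (\<lambda>\<omega>. \<lceil>?W \<omega> + c_seq m n\<rceil>)) {..r}) \<longlonglongrightarrow> 0"
      by (rule Lim_transform_eventually)
  next
    fix \<epsilon> :: real assume \<epsilon>: "0 < \<epsilon>"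
    interpret W: real_distribution "distr Q borel ?W"
      by (rule Q.real_distribution_distr) measurable
    have cdfW: "cdf (distr Q borel ?W) y = measure Q {\<omega> \<in> space Q. ?W \<omega> \<le> y}" for y
      unfolding cdf_def by (subst measure_distr) (auto intro!: arg_cong[where f = "measure Q"])
    obtain y0 where y0: "measure Q {\<omega> \<in> space Q. ?W \<omega> \<le> y0} < \<epsilon>"
      using eventually_happens[OF order_tendstoD(2)[OF W.cdf_lim_at_bot \<epsilon>]] by (auto simp: cdfW)
    obtain y1 where y1: "measure Q {\<omega> \<in> space Q. ?W \<omega> \<le> y1} > 1 - \<epsilon>"
      using eventually_happens[OF order_tendstoD(1)[OF W.cdf_lim_at_top_prob, of "1 - \<epsilon>"]] \<epsilon> by (auto simp: cdfW)
    define a where "a = \<lfloor>y0\<rfloor>"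
    \<comment> \<open>One extra unit absorbs the shift \<open>c_seq m n < 1\<close>.\<close>
    define b where "b = max a (\<lceil>y1\<rceil> + 1)"
    have Zle: "measure (distr Q (count_space UNIV) (\<lambda>\<omega>. \<lceil>?W \<omega> + c_seq m n\<rceil>)) {..r} =
        measure Q {\<omega> \<in> space Q. ?W \<omega> + c_seq m n \<le> of_int r}" for r :: int and n
      by (subst measure_distr) (auto intro!: arg_cong[where f = "measure Q"] simp: ceiling_le_iff)
    have "measure Q {\<omega> \<in> space Q. ?W \<omega> + c_seq m n \<le> of_int a} \<le> measure Q {\<omega> \<in> space Q. ?W \<omega> \<le> y0}" for n
    proof (rule Q.finite_measure_mono)
      have "of_int a \<le> y0"
        by (simp add: a_def)
      then show "{\<omega> \<in> space Q. ?W \<omega> + c_seq m n \<le> of_int a} \<subseteq> {\<omega> \<in> space Q. ?W \<omega> \<le> y0}"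
        using c01(1)[of n] by auto
    qed measurable
    moreover have "measure Q {\<omega> \<in> space Q. ?W \<omega> \<le> y1} \<le> measure Q {\<omega> \<in> space Q. ?W \<omega> + c_seq m n \<le> of_int b}" for n
    proof (rule Q.finite_measure_mono)
      have "of_int (\<lceil>y1\<rceil> + 1) \<le> (of_int b :: real)"
        unfolding of_int_le_iff by (simp add: b_def)
      then have "y1 + 1 \<le> of_int b"
        using le_of_int_ceiling[of y1] unfolding of_int_add of_int_1 by linarith
      then show "{\<omega> \<in> space Q. ?W \<omega> \<le> y1} \<subseteq> {\<omega> \<in> space Q. ?W \<omega> + c_seq m n \<le> of_int b}"
        using c01(2)[of n] by auto
    qed measurable
    ultimately show "\<exists>a b. a \<le> b \<and> (\<forall>n. measure (distr Q (count_space UNIV) (\<lambda>\<omega>. \<lceil>?W \<omega> + c_seq m n\<rceil>)) {..a} < \<epsilon> \<and>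
        1 - \<epsilon> < measure (distr Q (count_space UNIV) (\<lambda>\<omega>. \<lceil>?W \<omega> + c_seq m n\<rceil>)) {..b})"
      using y0 y1 unfolding Zle
      by (intro exI[of _ a] exI[of _ b]) (auto simp: b_def intro: le_less_trans less_le_trans)
  qed auto
qed

end
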